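(* Let $R$ be a ring and let $B$ be a right $R$-module with a proper submodule $A \subsetneq B$, $A\neq 0$. Suppose that $A$ and $C:=B/A$ are uniserial modules. Let $E_B$ be the endomorphism ring of the short exact sequence $0\to A\to B\to B/A\to 0$ viewed as an object of the category $\mathcal{E}$, i.e. $E_B=\{f\in \operatorname{End}_R(B)\mid f(A)\subseteq A\}$. Set $$I_{B,m,l}:=\{f\in E_B\mid \ker(f)\cap A\neq 0\},\qquad I_{B,e,l}:=\{f\in E_B\mid f(A)\subsetneq A\},$$ $$I_{B,m,u}:=\{f\in E_B\mid A\subsetneq f^{-1}(A)\},\qquad I_{B,e,u}:=\{f\in E_B\mid f(B)+A\subsetneq B\}.$$ Then $I_{B,m,l}, I_{B,e,l}, I_{B,m,u}, I_{B,e,u}$ are four two-sided completely prime ideals of $E_B$, and every proper right ideal of $E_B$ and every proper left ideal of $E_B$ is contained in one of these four ideals. Moreover, $E_B/J(E_B)$ is isomorphic to the direct product of $n$ division rings $D_1,\dots,D_n$ for some $n$ with $1\le n\le 4$, where $\{D_1,\dots,D_n\}\subseteq\{E_B/I_{B,m,l},\,E_B/I_{B,e,l},\,E_B/I_{B,m,u},\,E_B/I_{B,e,u}\}$.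
   Context: Rings are associative with identity and modules are unitary right modules. A module is uniserial if its lattice of submodules is linearly ordered under inclusion. The category $\mathcal{E}$ has as objects the short exact sequences $0\to A\xrightarrow{\alpha} B\xrightarrow{\beta} C\to 0$ of right $R$-modules; a morphism from such a sequence to $0\to A'\xrightarrow{\alpha'} B'\xrightarrow{\beta'} C'\to 0$ is an $R$-module morphism $f\colon B\to B'$ with $f(\alpha(A))\subseteq\alpha'(A')$. A completely prime ideal of a ring $S$ is a proper ideal $P$ of $S$ such that, for all $x,y\in S$, $xy\in P$ implies $x\in P$ or $y\in P$. $J(S)$ denotes the Jacobson radical of $S$. *)

theory Defs
  imports "HOL-Algebra.Algebra"
begin

section \<open>Right modules\<close>

text \<open>
  The library's \<^locale>\<open>module\<close> locale requires a commutative ring. Right modules over an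
  arbitrary ring reuse its record type and its \<^locale>\<open>submodule\<close> locale (which makes
  no assumption on the ring): the term \<open>r \<odot>\<^bsub>M\<^esub> x\<close> stands for the
  product \<open>x r\<close>, whence the order of the factors in \<open>smult_assoc\<close>.
\<close>

locale right_module = R?: ring R + M?: abelian_group M
  for R :: "('r, 'k) ring_scheme" (structure) and M :: "('r, 'b, 'm) module_scheme" (structure) +
  assumes smult_closed:
      "\<lbrakk>r \<in> carrier R; x \<in> carrier M\<rbrakk> \<Longrightarrow> r \<odot>\<^bsub>M\<^esub> x \<in> carrier M"
    and smult_add_scalar:
      "\<lbrakk>r \<in> carrier R; s \<in> carrier R; x \<in> carrier M\<rbrakk>
        \<Longrightarrow> (r \<oplus>\<^bsub>R\<^esub> s) \<odot>\<^bsub>M\<^esub> x = r \<odot>\<^bsub>M\<^esub> x \<oplus>\<^bsub>M\<^esub> s \<odot>\<^bsub>M\<^esub> x"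
    and smult_add_vector:
      "\<lbrakk>r \<in> carrier R; x \<in> carrier M; y \<in> carrier M\<rbrakk>
        \<Longrightarrow> r \<odot>\<^bsub>M\<^esub> (x \<oplus>\<^bsub>M\<^esub> y) = r \<odot>\<^bsub>M\<^esub> x \<oplus>\<^bsub>M\<^esub> r \<odot>\<^bsub>M\<^esub> y"
    and smult_assoc:
      "\<lbrakk>r \<in> carrier R; s \<in> carrier R; x \<in> carrier M\<rbrakk>
        \<Longrightarrow> (r \<otimes>\<^bsub>R\<^esub> s) \<odot>\<^bsub>M\<^esub> x = s \<odot>\<^bsub>M\<^esub> (r \<odot>\<^bsub>M\<^esub> x)"
    and smult_one: "x \<in> carrier M \<Longrightarrow> \<one>\<^bsub>R\<^esub> \<odot>\<^bsub>M\<^esub> x = x"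

definition uniserial :: "('r, 'k) ring_scheme \<Rightarrow> ('r, 'b, 'm) module_scheme \<Rightarrow> bool"
  where "uniserial R M \<longleftrightarrow>
    (\<forall>H K. submodule H R M \<and> submodule K R M \<longrightarrow> H \<subseteq> K \<or> K \<subseteq> H)"

text \<open>
  The fields \<open>mult\<close> and \<open>one\<close>, inherited from the ring record, play no role in a module.
\<close>

definition quotient_module :: "('r, 'b, 'm) module_scheme \<Rightarrow> 'b set \<Rightarrow> ('r, 'b set) module"
  where "quotient_module M H =
    \<lparr>carrier = a_rcosets\<^bsub>M\<^esub> H, monoid.mult = undefined, one = undefined, ring.zero = H, add = set_add M,
     smult = (\<lambda>r C. \<Union>x\<in>C. H +>\<^bsub>M\<^esub> (r \<odot>\<^bsub>M\<^esub> x))\<rparr>"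


section \<open>Endomorphism rings\<close>

text \<open>
  Endomorphisms are taken to be extensional (\<^const>\<open>undefined\<close> outside the carrier), so that
  equality of functions is equality of endomorphisms. The product is \<open>f g = f \<circ> g\<close>.
\<close>

definition module_endo :: "('r, 'k) ring_scheme \<Rightarrow> ('r, 'b, 'm) module_scheme \<Rightarrow> ('b \<Rightarrow> 'b) set"
  where "module_endo R M =
    {f \<in> hom (add_monoid M) (add_monoid M) \<inter> extensional (carrier M).
      \<forall>r\<in>carrier R. \<forall>x\<in>carrier M. f (r \<odot>\<^bsub>M\<^esub> x) = r \<odot>\<^bsub>M\<^esub> f x}"

definition End_ring :: "('r, 'k) ring_scheme \<Rightarrow> ('r, 'b, 'm) module_scheme \<Rightarrow> ('b \<Rightarrow> 'b) ring"
  where "End_ring R M =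
    \<lparr>carrier = module_endo R M, monoid.mult = compose (carrier M), one = (\<lambda>x\<in>carrier M. x),
     ring.zero = (\<lambda>x\<in>carrier M. \<zero>\<^bsub>M\<^esub>), add = (\<lambda>f g. \<lambda>x\<in>carrier M. f x \<oplus>\<^bsub>M\<^esub> g x)\<rparr>"

text \<open>
  The endomorphism ring of the short exact sequence \<open>0 \<rightarrow> A \<rightarrow> B \<rightarrow> B/A \<rightarrow> 0\<close>, as an
  object of the category of short exact sequences: its endomorphisms are the endomorphisms of
  \<open>B\<close> mapping \<open>A\<close> into itself. In the names below, \<open>m\<close> and \<open>e\<close> refer to failure of
  injectivity and surjectivity, \<open>l\<close> and \<open>u\<close> to the maps induced on \<open>A\<close> and \<open>B/A\<close>.
\<close>

definition E_ring ::
    "('r, 'k) ring_scheme \<Rightarrow> ('r, 'b, 'm) module_scheme \<Rightarrow> 'b set \<Rightarrow> ('b \<Rightarrow> 'b) ring"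
  where "E_ring R B A = (End_ring R B)\<lparr>carrier := {f \<in> carrier (End_ring R B). f ` A \<subseteq> A}\<rparr>"

definition I_ml :: "('r, 'k) ring_scheme \<Rightarrow> ('r, 'b, 'm) module_scheme \<Rightarrow> 'b set \<Rightarrow> ('b \<Rightarrow> 'b) set"
  where "I_ml R B A = {f \<in> carrier (E_ring R B A). a_kernel B B f \<inter> A \<noteq> {\<zero>\<^bsub>B\<^esub>}}"

definition I_el :: "('r, 'k) ring_scheme \<Rightarrow> ('r, 'b, 'm) module_scheme \<Rightarrow> 'b set \<Rightarrow> ('b \<Rightarrow> 'b) set"
  where "I_el R B A = {f \<in> carrier (E_ring R B A). f ` A \<subset> A}"

definition I_mu :: "('r, 'k) ring_scheme \<Rightarrow> ('r, 'b, 'm) module_scheme \<Rightarrow> 'b set \<Rightarrow> ('b \<Rightarrow> 'b) set"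
  where "I_mu R B A = {f \<in> carrier (E_ring R B A). A \<subset> {x \<in> carrier B. f x \<in> A}}"

definition I_eu :: "('r, 'k) ring_scheme \<Rightarrow> ('r, 'b, 'm) module_scheme \<Rightarrow> 'b set \<Rightarrow> ('b \<Rightarrow> 'b) set"
  where "I_eu R B A = {f \<in> carrier (E_ring R B A). f ` carrier B <+>\<^bsub>B\<^esub> A \<subset> carrier B}"


section \<open>Noncommutative ring theory\<close>

locale right_ideal = additive_subgroup I S + ring S for I and S (structure) +
  assumes right_closed: "\<lbrakk>a \<in> I; x \<in> carrier S\<rbrakk> \<Longrightarrow> a \<otimes> x \<in> I"

locale left_ideal = additive_subgroup I S + ring S for I and S (structure) +
  assumes left_closed: "\<lbrakk>a \<in> I; x \<in> carrier S\<rbrakk> \<Longrightarrow> x \<otimes> a \<in> I"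

locale completely_prime_ideal = ideal P S for P and S (structure) +
  assumes proper: "P \<noteq> carrier S"
    and completely_prime:
      "\<lbrakk>x \<in> carrier S; y \<in> carrier S; x \<otimes> y \<in> P\<rbrakk> \<Longrightarrow> x \<in> P \<or> y \<in> P"

definition maximal_right_ideal :: "'a set \<Rightarrow> ('a, 'k) ring_scheme \<Rightarrow> bool"
  where "maximal_right_ideal I S \<longleftrightarrow> right_ideal I S \<and> I \<noteq> carrier S \<and>
    (\<forall>K. right_ideal K S \<and> I \<subseteq> K \<longrightarrow> K = I \<or> K = carrier S)"

text \<open>Intersecting with the carrier makes the radical of the zero ring the whole ring.\<close>

definition jacobson_radical :: "('a, 'k) ring_scheme \<Rightarrow> 'a set"
  where "jacobson_radical S = carrier S \<inter> \<Inter> {I. maximal_right_ideal I S}"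

text \<open>A division ring, i.e. a not necessarily commutative field.\<close>

locale skew_field = ring D for D (structure) +
  assumes one_neq_zero: "\<one> \<noteq> \<zero>"
    and units: "Units D = carrier D - {\<zero>}"


section \<open>Well-definedness\<close>

lemma (in right_module) quotient_smult:
  assumes A: "submodule A R M" and r: "r \<in> carrier R" and x: "x \<in> carrier M"
  shows "r \<odot>\<^bsub>quotient_module M A\<^esub> (A +>\<^bsub>M\<^esub> x) = A +>\<^bsub>M\<^esub> (r \<odot>\<^bsub>M\<^esub> x)"
proof -
  interpret A: submodule A R M by fact
  interpret A: additive_subgroup A M
    by (rule additive_subgroup.intro) (rule A.subgroup_axioms)
  have eq: "A +>\<^bsub>M\<^esub> (r \<odot>\<^bsub>M\<^esub> y) = A +>\<^bsub>M\<^esub> (r \<odot>\<^bsub>M\<^esub> x)" if y: "y \<in> A +>\<^bsub>M\<^esub> x" for y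
  proof -
    obtain a where a: "a \<in> A" "y = a \<oplus>\<^bsub>M\<^esub> x"
      using y by (auto simp: a_r_coset_def')
    have "r \<odot>\<^bsub>M\<^esub> y = r \<odot>\<^bsub>M\<^esub> a \<oplus>\<^bsub>M\<^esub> r \<odot>\<^bsub>M\<^esub> x"
      using a r x by (simp add: smult_add_vector)
    moreover have "r \<odot>\<^bsub>M\<^esub> a \<in> A" using a r by (simp add: A.smult_closed)
    ultimately have "r \<odot>\<^bsub>M\<^esub> y \<in> A +>\<^bsub>M\<^esub> (r \<odot>\<^bsub>M\<^esub> x)"
      by (auto simp: a_r_coset_def')
    then show ?thesis
      using M.a_repr_independence[OF _ smult_closed[OF r x] A.a_subgroup] by simp
  qed
  have "x \<in> A +>\<^bsub>M\<^esub> x"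
    using x A.zero_closed by (force simp: a_r_coset_def')
  then have "(\<Union>y\<in>A +>\<^bsub>M\<^esub> x. A +>\<^bsub>M\<^esub> (r \<odot>\<^bsub>M\<^esub> y)) = A +>\<^bsub>M\<^esub> (r \<odot>\<^bsub>M\<^esub> x)"
    using eq by blast
  then show ?thesis
    by (simp add: quotient_module_def)
qed

lemma (in right_module) quotient_right_module:
  assumes A: "submodule A R M"
  shows "right_module R (quotient_module M A)"
proof -
  interpret A: submodule A R M by fact
  interpret A: additive_subgroup A M
    by (rule additive_subgroup.intro) (rule A.subgroup_axioms)
  interpret A: abelian_subgroup A M
    by (rule abelian_subgroupI3) (rule A.additive_subgroup_axioms, rule M.abelian_group_axioms)
  let ?Q = "quotient_module M A"
  have carr: "C \<in> carrier ?Q \<longleftrightarrow> (\<exists>x\<in>carrier M. C = A +>\<^bsub>M\<^esub> x)" for C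
    by (auto simp: quotient_module_def A_RCOSETS_def')
  have add: "(A +>\<^bsub>M\<^esub> x) \<oplus>\<^bsub>?Q\<^esub> (A +>\<^bsub>M\<^esub> y) = A +>\<^bsub>M\<^esub> (x \<oplus>\<^bsub>M\<^esub> y)"
    if "x \<in> carrier M" "y \<in> carrier M" for x y
    using that by (simp add: quotient_module_def A.a_rcos_sum)
  have zero: "\<zero>\<^bsub>?Q\<^esub> = A +>\<^bsub>M\<^esub> \<zero>\<^bsub>M\<^esub>"
    by (simp add: quotient_module_def M.a_coset_add_zero A.a_subset)
  have "abelian_group ?Q"
  proof (rule abelian_groupI)
    fix C assume "C \<in> carrier ?Q"
    then obtain x where x: "x \<in> carrier M" "C = A +>\<^bsub>M\<^esub> x" by (auto simp: carr)
    show "\<exists>D\<in>carrier ?Q. D \<oplus>\<^bsub>?Q\<^esub> C = \<zero>\<^bsub>?Q\<^esub>"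
      by (rule bexI[of _ "A +>\<^bsub>M\<^esub> (\<ominus>\<^bsub>M\<^esub> x)"]) (use x in \<open>auto simp: carr add zero M.l_neg\<close>)
  qed (auto simp: carr add zero M.a_ac)
  then show ?thesis
    by (intro right_module.intro right_module_axioms.intro R.ring_axioms)
      (auto simp: carr add quotient_smult[OF A] smult_closed smult_add_scalar smult_add_vector
         smult_assoc smult_one)
qed

lemma (in right_module) End_ring_ring: "ring (End_ring R M)"
proof -
  let ?E = "End_ring R M"
  have carrD: "\<And>f x. \<lbrakk>f \<in> carrier ?E; x \<in> carrier M\<rbrakk> \<Longrightarrow> f x \<in> carrier M"
    "\<And>f x y. \<lbrakk>f \<in> carrier ?E; x \<in> carrier M; y \<in> carrier M\<rbrakk> \<Longrightarrow> f (x \<oplus>\<^bsub>M\<^esub> y) = f x \<oplus>\<^bsub>M\<^esub> f y"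
    "\<And>f x r. \<lbrakk>f \<in> carrier ?E; x \<in> carrier M; r \<in> carrier R\<rbrakk> \<Longrightarrow> f (r \<odot>\<^bsub>M\<^esub> x) = r \<odot>\<^bsub>M\<^esub> f x"
    by (auto simp: End_ring_def module_endo_def hom_def)
  have ext: "f \<in> extensional (carrier M)" if "f \<in> carrier ?E" for f
    using that by (auto simp: End_ring_def module_endo_def)
  have carrI: "(\<lambda>x\<in>carrier M. f x) \<in> carrier ?E"
    if "\<And>x. x \<in> carrier M \<Longrightarrow> f x \<in> carrier M"
      "\<And>x y. \<lbrakk>x \<in> carrier M; y \<in> carrier M\<rbrakk> \<Longrightarrow> f (x \<oplus>\<^bsub>M\<^esub> y) = f x \<oplus>\<^bsub>M\<^esub> f y"
      "\<And>r x. \<lbrakk>r \<in> carrier R; x \<in> carrier M\<rbrakk> \<Longrightarrow> f (r \<odot>\<^bsub>M\<^esub> x) = r \<odot>\<^bsub>M\<^esub> f x" for f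
    using that by (auto simp: End_ring_def module_endo_def hom_def smult_closed)
  have ops: "f \<otimes>\<^bsub>?E\<^esub> g = (\<lambda>x\<in>carrier M. f (g x))" "\<one>\<^bsub>?E\<^esub> = (\<lambda>x\<in>carrier M. x)"
    "f \<oplus>\<^bsub>?E\<^esub> g = (\<lambda>x\<in>carrier M. f x \<oplus>\<^bsub>M\<^esub> g x)" "\<zero>\<^bsub>?E\<^esub> = (\<lambda>x\<in>carrier M. \<zero>\<^bsub>M\<^esub>)" for f g
    by (auto simp: End_ring_def compose_def)
  have sm0: "r \<odot>\<^bsub>M\<^esub> \<zero>\<^bsub>M\<^esub> = \<zero>\<^bsub>M\<^esub>" if "r \<in> carrier R" for r
    using smult_add_vector[OF that, of "\<zero>\<^bsub>M\<^esub>" "\<zero>\<^bsub>M\<^esub>"] smult_closed[OF that, of "\<zero>\<^bsub>M\<^esub>"]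
    by (metis M.add.r_cancel_one' M.r_zero M.zero_closed)
  have smn: "r \<odot>\<^bsub>M\<^esub> (\<ominus>\<^bsub>M\<^esub> x) = \<ominus>\<^bsub>M\<^esub> (r \<odot>\<^bsub>M\<^esub> x)" if "r \<in> carrier R" "x \<in> carrier M" for r x
    using smult_add_vector[OF that(1), of "\<ominus>\<^bsub>M\<^esub> x" x] smult_closed[OF that(1)] that sm0
    by (metis M.a_inv_closed M.l_neg M.minus_equality)
  have closed: "f \<otimes>\<^bsub>?E\<^esub> g \<in> carrier ?E" "f \<oplus>\<^bsub>?E\<^esub> g \<in> carrier ?E"
    if "f \<in> carrier ?E" "g \<in> carrier ?E" for f g
    unfolding ops using that
    by (intro carrI; simp add: carrD smult_add_vector M.a_ac)+
  have neg: "(\<lambda>x\<in>carrier M. \<ominus>\<^bsub>M\<^esub> f x) \<in> carrier ?E" if "f \<in> carrier ?E" for f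
    using that by (intro carrI; simp add: carrD M.minus_add smn)
  have one: "\<one>\<^bsub>?E\<^esub> \<in> carrier ?E" "\<zero>\<^bsub>?E\<^esub> \<in> carrier ?E"
    unfolding ops by (intro carrI; simp add: sm0)+
  have eqI: "f = g" if "f \<in> carrier ?E" "g \<in> carrier ?E" "\<And>x. x \<in> carrier M \<Longrightarrow> f x = g x" for f g
    using that ext by (meson extensionalityI)
  have ag: "abelian_group ?E"
  proof (rule abelian_groupI)
    fix f assume f: "f \<in> carrier ?E"
    show "\<exists>g\<in>carrier ?E. g \<oplus>\<^bsub>?E\<^esub> f = \<zero>\<^bsub>?E\<^esub>"
    proof
      show "(\<lambda>x\<in>carrier M. \<ominus>\<^bsub>M\<^esub> f x) \<in> carrier ?E" using neg[OF f] .
    qed (auto simp: ops carrD f M.l_neg fun_eq_iff restrict_def)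
  next
    fix f assume f: "f \<in> carrier ?E"
    have "(\<zero>\<^bsub>?E\<^esub> \<oplus>\<^bsub>?E\<^esub> f) x = f x" if "x \<in> carrier M" for x
      using that f by (simp add: ops carrD)
    then show "\<zero>\<^bsub>?E\<^esub> \<oplus>\<^bsub>?E\<^esub> f = f"
      by (intro eqI closed one f)
  next
    fix f g assume "f \<in> carrier ?E" "g \<in> carrier ?E"
    then show "f \<oplus>\<^bsub>?E\<^esub> g \<in> carrier ?E" by (rule closed)
  next
    show "\<zero>\<^bsub>?E\<^esub> \<in> carrier ?E" by (rule one)
  next
    fix f g assume "f \<in> carrier ?E" "g \<in> carrier ?E"
    then show "f \<oplus>\<^bsub>?E\<^esub> g = g \<oplus>\<^bsub>?E\<^esub> f"
      by (auto simp: ops carrD M.a_ac fun_eq_iff restrict_def)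
  next
    fix f g h assume "f \<in> carrier ?E" "g \<in> carrier ?E" "h \<in> carrier ?E"
    then show "(f \<oplus>\<^bsub>?E\<^esub> g) \<oplus>\<^bsub>?E\<^esub> h = f \<oplus>\<^bsub>?E\<^esub> (g \<oplus>\<^bsub>?E\<^esub> h)"
      by (auto simp: ops carrD M.a_ac fun_eq_iff restrict_def)
  qed
  have mon: "Group.monoid ?E"
  proof (rule monoidI)
    fix f g h assume fgh: "f \<in> carrier ?E" "g \<in> carrier ?E" "h \<in> carrier ?E"
    show "(f \<otimes>\<^bsub>?E\<^esub> g) \<otimes>\<^bsub>?E\<^esub> h = f \<otimes>\<^bsub>?E\<^esub> (g \<otimes>\<^bsub>?E\<^esub> h)"
      using fgh by (simp add: ops carrD fun_eq_iff restrict_def)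
  next
    fix f assume f: "f \<in> carrier ?E"
    show "\<one>\<^bsub>?E\<^esub> \<otimes>\<^bsub>?E\<^esub> f = f"
      by (rule eqI) (use f in \<open>simp_all add: closed one\<close>, simp add: ops carrD)
    show "f \<otimes>\<^bsub>?E\<^esub> \<one>\<^bsub>?E\<^esub> = f"
      by (rule eqI) (use f in \<open>simp_all add: closed one\<close>, simp add: ops carrD)
  qed (rule closed one; assumption)+
  show ?thesis
  proof (intro ringI ag mon)
    fix f g h assume fgh: "f \<in> carrier ?E" "g \<in> carrier ?E" "h \<in> carrier ?E"
    show "(f \<oplus>\<^bsub>?E\<^esub> g) \<otimes>\<^bsub>?E\<^esub> h = f \<otimes>\<^bsub>?E\<^esub> h \<oplus>\<^bsub>?E\<^esub> g \<otimes>\<^bsub>?E\<^esub> h"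
      using fgh by (simp add: ops carrD fun_eq_iff restrict_def)
    show "h \<otimes>\<^bsub>?E\<^esub> (f \<oplus>\<^bsub>?E\<^esub> g) = h \<otimes>\<^bsub>?E\<^esub> f \<oplus>\<^bsub>?E\<^esub> h \<otimes>\<^bsub>?E\<^esub> g"
      using fgh by (simp add: ops carrD fun_eq_iff restrict_def)
  qed
qed

end

theory Submission
  imports Defs
begin

text \<open>
  If \<open>H \<subset> K\<close> are \<open>E\<close>-stable submodules with \<open>K/H\<close> uniserial, comparing kernels, respectively images,
  of the endomorphisms induced on \<open>K/H\<close> shows that the elements of \<open>E\<close> inducing a noninjective map, and
  those inducing a nonsurjective one, form completely prime ideals. Taking \<open>K/H\<close> to be \<open>A/0\<close> and \<open>B/A\<close>
  gives the four ideals, and an element outside all of them is an automorphism, so the nonunits of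
  \<open>E\<close> are the union of the four ideals. By prime avoidance every proper one-sided ideal then lies
  in one of them. Hence the maximal right ideals are exactly the maximal members of the family; they
  are two-sided and pairwise comaximal, and the Chinese remainder theorem describes \<open>E/J(E)\<close>.
\<close>

section \<open>Rings whose nonunits are a finite union of completely prime ideals\<close>

context ring
begin

section \<open>One-sided ideals, units and prime avoidance\<close>

lemma ideal_imp_right_ideal: "ideal I R \<Longrightarrow> right_ideal I R"
  by (simp add: ideal_def ideal_axioms_def right_ideal_def right_ideal_axioms_def)

text \<open>Closure under negation comes for free, since \<open>\<ominus> x\<close> is the right
  multiple of \<open>x\<close> by \<open>\<ominus> \<one>\<close>.\<close>

lemma right_idealI:
  assumes "I \<subseteq> carrier R" "\<zero> \<in> I"
    and "\<And>x y. \<lbrakk>x \<in> I; y \<in> I\<rbrakk> \<Longrightarrow> x \<oplus> y \<in> I"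
    and closed: "\<And>x y. \<lbrakk>x \<in> I; y \<in> carrier R\<rbrakk> \<Longrightarrow> x \<otimes> y \<in> I"
  shows "right_ideal I R"
proof -
  have "\<ominus> x \<in> I" if "x \<in> I" for x
  proof -
    have "x \<otimes> (\<ominus> \<one>) \<in> I" using that by (intro closed) auto
    moreover have "x \<otimes> (\<ominus> \<one>) = \<ominus> x"
      using that assms(1) by (simp add: r_minus subset_iff)
    ultimately show ?thesis by simp
  qed
  then have "subgroup I (add_monoid R)"
    using assms by (intro add.subgroupI) (auto simp: a_inv_def)
  then show ?thesis
    using closed by (intro right_ideal.intro right_ideal_axioms.intro additive_subgroup.intro ring_axioms)
qed

lemma right_ideal_with_unit:
  assumes "right_ideal K R" "u \<in> K" "u \<in> Units R"
  shows "K = carrier R"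
proof -
  interpret K: right_ideal K R by fact
  have "\<one> \<in> K"
    using K.right_closed[OF assms(2), of "inv u"] assms(3) by (simp add: Units_r_inv)
  then have "x \<in> K" if "x \<in> carrier R" for x
    using K.right_closed[of \<one> x] that by simp
  then show ?thesis using K.a_subset by auto
qed

lemma left_ideal_with_unit:
  assumes "left_ideal K R" "u \<in> K" "u \<in> Units R"
  shows "K = carrier R"
proof -
  interpret K: left_ideal K R by fact
  have "\<one> \<in> K"
    using K.left_closed[OF assms(2), of "inv u"] assms(3) by (simp add: Units_l_inv)
  then have "x \<in> K" if "x \<in> carrier R" for x
    using K.left_closed[of \<one> x] that by simp
  then show ?thesis using K.a_subset by auto
qed

text \<open>The witness is a product of elements outside \<open>P\<close>, one from each
  \<open>Q\<close>: complete primeness keeps it outside \<open>P\<close>, and two-sidedness puts it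
  in every \<open>Q\<close>. Letting \<open>K\<close> be any multiplicatively closed set serves both
  prime avoidance and the Chinese remainder theorem, where \<open>K\<close> is the whole
  ring.\<close>

lemma common_element_outside_prime:
  assumes "finite T" "T \<noteq> {}" and P: "completely_prime_ideal P R"
    and T: "\<And>Q. Q \<in> T \<Longrightarrow> ideal Q R"
    and K: "K \<subseteq> carrier R" "\<And>x y. \<lbrakk>x \<in> K; y \<in> K\<rbrakk> \<Longrightarrow> x \<otimes> y \<in> K"
    and ex: "\<And>Q. Q \<in> T \<Longrightarrow> \<exists>x\<in>K. x \<in> Q \<and> x \<notin> P"
  shows "\<exists>y\<in>K. y \<notin> P \<and> (\<forall>Q\<in>T. y \<in> Q)"
  using assms(1,2) T ex
proof (induction T rule: finite_ne_induct)
  case (singleton Q)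
  then show ?case by auto
next
  case (insert Q T)
  obtain y where y: "y \<in> K" "y \<notin> P" "\<forall>Q\<in>T. y \<in> Q"
    using insert by (metis insertCI)
  obtain x where x: "x \<in> K" "x \<in> Q" "x \<notin> P"
    using insert.prems(2) by blast
  have "x \<otimes> y \<notin> P"
    using completely_prime_ideal.completely_prime[OF P, of x y] x y K(1) by blast
  moreover have "x \<otimes> y \<in> Q'" if "Q' \<in> insert Q T" for Q'
  proof -
    interpret Q': ideal Q' R using insert.prems(1) that by blast
    show ?thesis using that x y K(1) Q'.I_l_closed Q'.I_r_closed by auto
  qed
  ultimately show ?case using K(2)[OF x(1) y(1)] by blast
qed

text \<open>Induction on the cover \<open>S\<close>: a member that the others make redundant is
  dropped. In an irredundant cover with at least two members, a suitable sum of two elements of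
  \<open>K\<close> would escape every member. Beyond being a nonempty part of the ring,
  \<open>K\<close> has only to be closed under sums and products, so left and right ideals are
  covered alike.\<close>

lemma prime_avoidance:
  assumes "finite S" and S: "\<And>P. P \<in> S \<Longrightarrow> completely_prime_ideal P R"
    and K: "K \<subseteq> carrier R" "K \<noteq> {}"
      "\<And>x y. \<lbrakk>x \<in> K; y \<in> K\<rbrakk> \<Longrightarrow> x \<oplus> y \<in> K"
      "\<And>x y. \<lbrakk>x \<in> K; y \<in> K\<rbrakk> \<Longrightarrow> x \<otimes> y \<in> K"
    and "K \<subseteq> \<Union>S"
  shows "\<exists>P\<in>S. K \<subseteq> P"
  using assms(1) S assms(7)
proof (induction S rule: finite_psubset_induct)
  case (psubset S)
  show ?case
  proof (cases "\<exists>P\<in>S. K \<subseteq> \<Union>(S - {P})")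
    case True
    then obtain P where P: "P \<in> S" "K \<subseteq> \<Union>(S - {P})" by blast
    have "\<exists>Q\<in>S - {P}. K \<subseteq> Q"
    proof (rule psubset.IH)
      show "S - {P} \<subset> S" using P(1) by blast
      show "completely_prime_ideal Q R" if "Q \<in> S - {P}" for Q
        using psubset.prems(1)[of Q] that by blast
      show "K \<subseteq> \<Union>(S - {P})" by fact
    qed
    then show ?thesis by blast
  next
    case False
    have ex: "\<exists>x\<in>K. x \<in> P \<and> (\<forall>Q\<in>S - {P}. x \<notin> Q)" if P: "P \<in> S" for P
    proof -
      obtain x where x: "x \<in> K" "x \<notin> \<Union>(S - {P})" using False P by blast
      then obtain Q where "Q \<in> S" "x \<in> Q" using subsetD[OF psubset.prems(2) x(1)] by blast
      with x have "x \<in> P" by (cases "Q = P") auto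
      with x show ?thesis by blast
    qed
    have "S \<noteq> {}" using K(2) psubset.prems(2) by auto
    then obtain P where P: "P \<in> S" by blast
    interpret P: completely_prime_ideal P R using psubset.prems(1) P .
    show ?thesis
    proof (cases "S - {P} = {}")
      case True
      with P have "S = {P}" by blast
      with psubset.prems(2) show ?thesis by simp
    next
      case nonempty: False
      have "\<exists>y\<in>K. y \<notin> P \<and> (\<forall>Q\<in>S - {P}. y \<in> Q)"
      proof (rule common_element_outside_prime[OF _ nonempty P.completely_prime_ideal_axioms _ K(1) K(4)])
        show "\<exists>x\<in>K. x \<in> Q \<and> x \<notin> P" if "Q \<in> S - {P}" for Q
          using ex[of Q] that P by blast
        show "ideal Q R" if "Q \<in> S - {P}" for Q
          using psubset.prems(1)[of Q] that by (simp add: completely_prime_ideal.axioms(1))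
        show "finite (S - {P})" using psubset.hyps by simp
      qed
      then obtain y where y: "y \<in> K" "y \<notin> P" "\<forall>Q\<in>S - {P}. y \<in> Q" by blast
      obtain x where x: "x \<in> K" "x \<in> P" "\<forall>Q\<in>S - {P}. x \<notin> Q" using ex[OF P] by blast
      have carr: "x \<in> carrier R" "y \<in> carrier R" using x y K(1) by auto
      \<comment> \<open>Here \<open>x\<close> lies in \<open>P\<close> only and \<open>y\<close> in
        every member except \<open>P\<close>. Hence no member can contain
        \<open>x \<oplus> y\<close>: subtracting \<open>x\<close> would put \<open>y\<close> into
        \<open>P\<close>, and subtracting \<open>y\<close> would put \<open>x\<close> into another
        member.\<close>
      obtain Q where Q: "Q \<in> S" "x \<oplus> y \<in> Q"
        using K(3)[OF x(1) y(1)] psubset.prems(2) by blast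
      interpret Q: ideal Q R
        using psubset.prems(1) Q completely_prime_ideal.axioms(1) by blast
      show ?thesis
      proof (cases "Q = P")
        case True
        have "\<ominus> x \<oplus> (x \<oplus> y) \<in> P"
          using Q True P.a_closed P.a_inv_closed x(2) by blast
        then show ?thesis using y(2) carr by (simp add: r_neg1)
      next
        case False
        have "(x \<oplus> y) \<oplus> \<ominus> y \<in> Q"
          using Q False y(3) Q.a_closed Q.a_inv_closed by blast
        then show ?thesis
          using x(3) Q(1) False carr by (simp add: a_assoc r_neg)
      qed
    qed
  qed
qed

section \<open>Division rings and the Chinese remainder theorem for maximal right ideals\<close>

lemma skew_fieldI_right_inverse:
  assumes "\<one> \<noteq> \<zero>"
    and inv: "\<And>x. \<lbrakk>x \<in> carrier R; x \<noteq> \<zero>\<rbrakk> \<Longrightarrow> \<exists>y\<in>carrier R. x \<otimes> y = \<one>"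
  shows "skew_field R"
proof -
  have "x \<in> Units R" if x: "x \<in> carrier R" "x \<noteq> \<zero>" for x
  proof -
    obtain y where y: "y \<in> carrier R" "x \<otimes> y = \<one>" using inv[OF x] by blast
    then have "y \<noteq> \<zero>" using assms(1) x by auto
    then obtain z where z: "z \<in> carrier R" "y \<otimes> z = \<one>" using inv[OF y(1)] by blast
    \<comment> \<open>The right inverse \<open>z\<close> of \<open>y\<close> agrees with
      \<open>x\<close>, so \<open>y\<close> is a left inverse of \<open>x\<close> as well.\<close>
    have "z = x \<otimes> y \<otimes> z" using y z by simp
    also have "\<dots> = x" using x y(1) z by (simp add: m_assoc)
    finally show ?thesis using x y z unfolding Units_def by blast
  qed
  moreover have "\<zero> \<notin> Units R" using assms(1) by (auto simp: Units_def)
  ultimately have "Units R = carrier R - {\<zero>}"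
    using Units_closed by blast
  then show ?thesis
    using assms(1) by (intro skew_field.intro skew_field_axioms.intro ring_axioms)
qed

text \<open>For \<open>x\<close> outside \<open>P\<close>, the right ideal \<open>xR + P\<close>
  strictly contains the maximal right ideal \<open>P\<close>, hence contains \<open>\<one>\<close>.
  Reading \<open>\<one> = xy + p\<close> modulo \<open>P\<close> yields a right inverse of the coset
  of \<open>x\<close>.\<close>

lemma quotient_skew_field:
  assumes "ideal P R" and max: "maximal_right_ideal P R"
  shows "skew_field (R Quot P)"
proof -
  interpret P: ideal P R by fact
  interpret Q: ring "R Quot P" by (rule P.quotient_is_ring)
  interpret h: ring_hom_ring R "R Quot P" "(+>) P" by (rule P.rcos_ring_hom_ring)
  have proper: "P \<noteq> carrier R"
    and maxD: "\<And>K. \<lbrakk>right_ideal K R; P \<subseteq> K; K \<noteq> P\<rbrakk> \<Longrightarrow> K = carrier R"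
    using max unfolding maximal_right_ideal_def by blast+
  have zero: "P +> x = \<zero>\<^bsub>R Quot P\<^esub> \<longleftrightarrow> x \<in> P" if "x \<in> carrier R" for x
    unfolding FactRing_def ring.simps
    using P.rcos_const_imp_mem[OF that] a_rcos_zero[OF P.is_ideal] by blast
  have "\<one> \<notin> P" using P.one_imp_carrier proper by (rule contrapos_nn[rotated])
  then have one: "\<one>\<^bsub>R Quot P\<^esub> \<noteq> \<zero>\<^bsub>R Quot P\<^esub>"
    using zero[of \<one>] h.hom_one by simp
  show ?thesis
  proof (rule Q.skew_fieldI_right_inverse[OF one])
    fix c assume c: "c \<in> carrier (R Quot P)" "c \<noteq> \<zero>\<^bsub>R Quot P\<^esub>"
    then obtain x where x: "x \<in> carrier R" "c = P +> x"
      unfolding FactRing_def A_RCOSETS_def' by auto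
    with c(2) have "x \<notin> P" unfolding x(2) zero[OF x(1)] by -
    define K where "K = {x \<otimes> y \<oplus> p | y p. y \<in> carrier R \<and> p \<in> P}"
    have K: "x \<otimes> y \<oplus> p \<in> K" if "y \<in> carrier R" "p \<in> P" for y p
      unfolding K_def using that by blast
    have "right_ideal K R"
    proof (rule right_idealI)
      show "K \<subseteq> carrier R" using x by (auto simp: K_def)
      show "\<zero> \<in> K" using K[of \<zero> \<zero>] x by simp
    next
      fix a b assume "a \<in> K" "b \<in> K"
      then obtain y p z q where *: "y \<in> carrier R" "z \<in> carrier R" "p \<in> P" "q \<in> P"
          "a = x \<otimes> y \<oplus> p" "b = x \<otimes> z \<oplus> q"
        by (auto simp: K_def)
      then have "a \<oplus> b = x \<otimes> (y \<oplus> z) \<oplus> (p \<oplus> q)"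
        using x(1) P.Icarr by (simp add: r_distr a_ac)
      then show "a \<oplus> b \<in> K" using K[of "y \<oplus> z" "p \<oplus> q"] * by simp
    next
      fix a b assume "a \<in> K" and b: "b \<in> carrier R"
      then obtain y p where *: "y \<in> carrier R" "p \<in> P" "a = x \<otimes> y \<oplus> p"
        by (auto simp: K_def)
      then have "a \<otimes> b = x \<otimes> (y \<otimes> b) \<oplus> p \<otimes> b"
        using x(1) b P.Icarr by (simp add: l_distr m_assoc)
      then show "a \<otimes> b \<in> K" using K[of "y \<otimes> b" "p \<otimes> b"] * b P.I_r_closed by simp
    qed
    moreover have "P \<subseteq> K"
    proof
      fix p assume "p \<in> P"
      then show "p \<in> K" using K[of \<zero> p] x(1) P.Icarr by simp
    qed
    moreover have "x \<in> K" using K[of \<one> \<zero>] x(1) by simp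
    ultimately have "\<one> \<in> K" using maxD \<open>x \<notin> P\<close> by blast
    then obtain y p where y: "y \<in> carrier R" "p \<in> P" "\<one> = x \<otimes> y \<oplus> p"
      by (auto simp: K_def)
    have "\<one>\<^bsub>R Quot P\<^esub> = c \<otimes>\<^bsub>R Quot P\<^esub> (P +> y) \<oplus>\<^bsub>R Quot P\<^esub> (P +> p)"
      using h.hom_one y x P.Icarr by (metis h.hom_add h.hom_mult m_closed)
    also have "P +> p = \<zero>\<^bsub>R Quot P\<^esub>" using zero y(2) P.Icarr by blast
    finally have "c \<otimes>\<^bsub>R Quot P\<^esub> (P +> y) = \<one>\<^bsub>R Quot P\<^esub>"
      using c(1) y(1) h.hom_closed by simp
    then show "\<exists>Y\<in>carrier (R Quot P). c \<otimes>\<^bsub>R Quot P\<^esub> Y = \<one>\<^bsub>R Quot P\<^esub>"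
      using y(1) h.hom_closed by blast
  qed
qed

text \<open>Induction on the list, splitting off one ideal \<open>P\<close> from the intersection
  \<open>I\<close> of the others. None of the others lies in \<open>P\<close>, because they are
  maximal and different from \<open>P\<close>; complete primeness then gives an element of
  \<open>I\<close> outside \<open>P\<close>, and maximality of \<open>P\<close> makes
  \<open>P\<close> and \<open>I\<close> comaximal.\<close>

lemma chinese_remainder_maximal_right:
  assumes "distinct Ps" "Ps \<noteq> []"
    and "\<And>P. P \<in> set Ps \<Longrightarrow> completely_prime_ideal P R"
    and "\<And>P. P \<in> set Ps \<Longrightarrow> maximal_right_ideal P R"
  shows "ideal (\<Inter>(set Ps)) R \<and> R Quot \<Inter>(set Ps) \<simeq> RDirProd_list (map ((Quot) R) Ps)"
  using assms
proof (induction Ps)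
  case Nil
  then show ?case by simp
next
  case (Cons P Ps)
  interpret P: completely_prime_ideal P R using Cons.prems by simp
  have maxP: "\<And>K. \<lbrakk>right_ideal K R; P \<subseteq> K; K \<noteq> P\<rbrakk> \<Longrightarrow> K = carrier R"
    using Cons.prems(4)[of P] by (auto simp: maximal_right_ideal_def)
  show ?case
  proof (cases "Ps = []")
    \<comment> \<open>The singleton list is the base case: the intersection of the empty family
      would be the whole type.\<close>
    case True
    have "R Quot P \<simeq> RDirProd_list [R Quot P]"
      using RDirProd_list_iso3[of "R Quot P"] unfolding is_ring_iso_def by blast
    then show ?thesis using True P.is_ideal by simp
  next
    case False
    define I where "I = \<Inter>(set Ps)"
    have IH: "ideal I R" "R Quot I \<simeq> RDirProd_list (map ((Quot) R) Ps)"
      using Cons False by (auto simp: I_def)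
    interpret I: ideal I R by fact
    have "\<exists>y\<in>carrier R. y \<notin> P \<and> (\<forall>Q\<in>set Ps. y \<in> Q)"
    proof (rule common_element_outside_prime[OF _ _ P.completely_prime_ideal_axioms])
      fix Q assume Q: "Q \<in> set Ps"
      then interpret Q: completely_prime_ideal Q R using Cons.prems by simp
      show "ideal Q R" by (rule Q.is_ideal)
      have "\<not> Q \<subseteq> P"
        using Cons.prems(1) Cons.prems(4)[of Q] Q P.proper ideal_imp_right_ideal[OF P.is_ideal]
        by (auto simp: maximal_right_ideal_def)
      then show "\<exists>x\<in>carrier R. x \<in> Q \<and> x \<notin> P" using Q.a_subset by blast
    qed (use False in auto)
    then have "\<not> I \<subseteq> P" by (auto simp: I_def)
    \<comment> \<open>The sum of two ideals is the ideal generated by their union.\<close>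
    moreover have "P \<union> I \<subseteq> P <+> I"
      using genideal_self[of "P \<union> I"] union_genideal[OF P.is_ideal I.is_ideal]
        P.a_subset I.a_subset by blast
    ultimately have comax: "P <+> I = carrier R"
      using maxP[OF ideal_imp_right_ideal[OF add_ideals[OF P.is_ideal I.is_ideal]]] by blast
    have "R Quot (P \<inter> I) \<simeq> RDirProd (R Quot P) (R Quot I)"
      using chinese_remainder_simple[OF P.is_ideal I.is_ideal comax] .
    \<comment> \<open>The inductive isomorphism acts on the second factor; a pair of an element and
      a list is then identified with the longer list.\<close>
    moreover obtain f where "f \<in> ring_iso (R Quot I) (RDirProd_list (map ((Quot) R) Ps))"
      using IH(2) unfolding is_ring_iso_def by blast
    then have "RDirProd (R Quot P) (R Quot I) \<simeq> RDirProd_list (map ((Quot) R) (P # Ps))"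
      using ring_iso_set_trans[OF RDirProd_iso5 RDirProd_list_iso1]
      unfolding is_ring_iso_def list.map by blast
    ultimately have "R Quot (P \<inter> I) \<simeq> RDirProd_list (map ((Quot) R) (P # Ps))"
      using ring_iso_set_trans unfolding is_ring_iso_def by blast
    then show ?thesis
      using i_intersect[OF P.is_ideal I.is_ideal] by (simp add: I_def)
  qed
qed

end

section \<open>Maximal right ideals and the radical when completely prime ideals cover the
  nonunits\<close>

locale semilocal_by_primes = ring +
  fixes S :: "'a set set"
  assumes finite_primes: "finite S" and primes_nonempty: "S \<noteq> {}"
    and primes: "P \<in> S \<Longrightarrow> completely_prime_ideal P R"
    and units_complement: "Units R = carrier R - \<Union>S"
begin

text \<open>A proper right ideal contains no unit, so it lies in the union of \<open>S\<close>, and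
  prime avoidance selects one member.\<close>

lemma proper_right_ideal_subset_prime:
  assumes "right_ideal K R" "K \<noteq> carrier R"
  shows "\<exists>P\<in>S. K \<subseteq> P"
proof -
  interpret K: right_ideal K R by fact
  have "K \<subseteq> \<Union>S"
    using right_ideal_with_unit[OF assms(1)] assms(2) units_complement K.a_subset by blast
  then show ?thesis
  proof (rule prime_avoidance[OF finite_primes primes K.a_subset, rotated -1])
    show "K \<noteq> {}" using K.zero_closed by blast
    show "x \<otimes> y \<in> K" if "x \<in> K" "y \<in> K" for x y
      using K.right_closed[OF that(1)] subsetD[OF K.a_subset that(2)] by simp
  qed (simp_all only: K.a_closed)
qed

lemma proper_left_ideal_subset_prime:
  assumes "left_ideal K R" "K \<noteq> carrier R"
  shows "\<exists>P\<in>S. K \<subseteq> P"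
proof -
  interpret K: left_ideal K R by fact
  have "K \<subseteq> \<Union>S"
    using left_ideal_with_unit[OF assms(1)] assms(2) units_complement K.a_subset by blast
  then show ?thesis
  proof (rule prime_avoidance[OF finite_primes primes K.a_subset, rotated -1])
    show "K \<noteq> {}" using K.zero_closed by blast
    show "x \<otimes> y \<in> K" if "x \<in> K" "y \<in> K" for x y
      using K.left_closed[OF that(2)] subsetD[OF K.a_subset that(1)] by simp
  qed (simp_all only: K.a_closed)
qed

text \<open>Every proper right ideal lies in a member of \<open>S\<close>, and these members are
  themselves proper right ideals; so maximality may be tested within \<open>S\<close>. In particular
  the maximal right ideals are two-sided and completely prime.\<close>

lemma maximal_right_ideal_iff_maximal_prime:
  "maximal_right_ideal K R \<longleftrightarrow> K \<in> S \<and> (\<forall>P\<in>S. K \<subseteq> P \<longrightarrow> P = K)"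
proof
  assume K: "maximal_right_ideal K R"
  have eq: "\<forall>P\<in>S. K \<subseteq> P \<longrightarrow> P = K"
  proof (intro ballI impI)
    fix P assume P: "P \<in> S" "K \<subseteq> P"
    then interpret P: completely_prime_ideal P R by (intro primes)
    have "P = K \<or> P = carrier R"
      using K P(2) ideal_imp_right_ideal[OF P.is_ideal] unfolding maximal_right_ideal_def by blast
    then show "P = K" using P.proper by (elim disjE) simp_all
  qed
  obtain P where "P \<in> S" "K \<subseteq> P"
    using K proper_right_ideal_subset_prime[of K] unfolding maximal_right_ideal_def by (elim conjE) metis
  with eq show "K \<in> S \<and> (\<forall>P\<in>S. K \<subseteq> P \<longrightarrow> P = K)" by (metis (no_types))
next
  assume K: "K \<in> S \<and> (\<forall>P\<in>S. K \<subseteq> P \<longrightarrow> P = K)"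
  then interpret K: completely_prime_ideal K R using primes by blast
  show "maximal_right_ideal K R"
    unfolding maximal_right_ideal_def
  proof (intro conjI allI impI K.proper ideal_imp_right_ideal[OF K.is_ideal])
    fix L assume L: "right_ideal L R \<and> K \<subseteq> L"
    show "L = K \<or> L = carrier R"
    proof (rule ccontr)
      assume *: "\<not> (L = K \<or> L = carrier R)"
      then obtain P where P: "P \<in> S" "L \<subseteq> P" using L proper_right_ideal_subset_prime[of L] by auto
      then have "P = K" using L K by (meson subset_trans)
      then show False using L P * by (meson subset_antisym)
    qed
  qed
qed

text \<open>The factors are the quotients by the maximal right ideals. These form a subfamily of
  \<open>S\<close>, which bounds their number, and the finite nonempty family \<open>S\<close> has a
  maximal member, so there is at least one.\<close>

theorem quotient_by_jacobson_radical:
  "\<exists>Ds. 1 \<le> length Ds \<and> length Ds \<le> card S \<and> (\<forall>D\<in>set Ds. skew_field D)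
     \<and> set Ds \<subseteq> (Quot) R ` S \<and> R Quot jacobson_radical R \<simeq> RDirProd_list Ds"
proof -
  define M where "M = {P. maximal_right_ideal P R}"
  have M: "M \<subseteq> S" by (auto simp: M_def maximal_right_ideal_iff_maximal_prime)
  then have fin: "finite M" using finite_primes finite_subset by blast
  obtain P where "P \<in> S" "\<forall>Q\<in>S. P \<subseteq> Q \<longrightarrow> P = Q"
    using finite_has_maximal[OF finite_primes primes_nonempty] by blast
  then have "P \<in> M" by (auto simp: M_def maximal_right_ideal_iff_maximal_prime)
  \<comment> \<open>Listing \<open>M\<close> without repetition makes the entries pairwise comaximal
    and the length equal to the cardinality of \<open>M\<close>.\<close>
  obtain Ps where Ps: "set Ps = M" "distinct Ps" using finite_distinct_list[OF fin] by blast
  have "Ps \<noteq> []" using \<open>P \<in> M\<close> Ps by auto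
  have iso: "R Quot \<Inter>M \<simeq> RDirProd_list (map ((Quot) R) Ps)"
  proof -
    have "completely_prime_ideal P R" "maximal_right_ideal P R" if "P \<in> set Ps" for P
      using that primes[of P] Ps(1) M by (auto simp: M_def)
    from chinese_remainder_maximal_right[OF Ps(2) \<open>Ps \<noteq> []\<close> this] show ?thesis
      by (simp add: Ps(1))
  qed
  \<comment> \<open>Nonemptiness of \<open>M\<close> keeps its intersection inside the
    carrier.\<close>
  have "\<Inter>M \<subseteq> carrier R"
  proof -
    interpret P: completely_prime_ideal P R by (rule primes) fact
    show ?thesis using \<open>P \<in> M\<close> P.a_subset by blast
  qed
  then have "jacobson_radical R = \<Inter>M"
    unfolding jacobson_radical_def M_def by (rule Int_absorb1)
  moreover have "skew_field (R Quot Q)" if "Q \<in> M" for Q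
  proof (rule quotient_skew_field)
    show "ideal Q R" using primes[of Q] that M by (auto intro: completely_prime_ideal.axioms(1))
    show "maximal_right_ideal Q R" using that by (simp add: M_def)
  qed
  moreover have "length Ps \<le> card S"
    using card_mono[OF finite_primes M] distinct_card[OF Ps(2)] Ps(1) by simp
  ultimately show ?thesis
    using iso Ps(1) M \<open>Ps \<noteq> []\<close>
    by (intro exI[of _ "map ((Quot) R) Ps"]) (auto simp: Suc_le_eq)
qed

end

section \<open>Endomorphisms of a submodule pair\<close>

context right_module
begin

section \<open>Elementary consequences of the module axioms\<close>

lemma submodule_imp_additive_subgroup: "submodule H R M \<Longrightarrow> additive_subgroup H M"
  by (simp add: submodule_def additive_subgroup_def)

lemma smult_zero: "r \<in> carrier R \<Longrightarrow> r \<odot>\<^bsub>M\<^esub> \<zero>\<^bsub>M\<^esub> = \<zero>\<^bsub>M\<^esub>"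
  using smult_add_vector[of r "\<zero>\<^bsub>M\<^esub>" "\<zero>\<^bsub>M\<^esub>"] smult_closed[of r "\<zero>\<^bsub>M\<^esub>"]
  by (metis M.add.r_cancel_one' M.r_zero M.zero_closed)

lemma zero_smult: "x \<in> carrier M \<Longrightarrow> \<zero>\<^bsub>R\<^esub> \<odot>\<^bsub>M\<^esub> x = \<zero>\<^bsub>M\<^esub>"
  using smult_add_scalar[of "\<zero>\<^bsub>R\<^esub>" "\<zero>\<^bsub>R\<^esub>" x] smult_closed[of "\<zero>\<^bsub>R\<^esub>" x]
  by (metis M.add.r_cancel_one' R.r_zero R.zero_closed)

text \<open>Reduces closure of submodules under negation, and compatibility of endomorphisms with
  it, to the corresponding facts about scalars.\<close>

lemma minus_one_smult:
  assumes x: "x \<in> carrier M"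
  shows "(\<ominus>\<^bsub>R\<^esub> \<one>\<^bsub>R\<^esub>) \<odot>\<^bsub>M\<^esub> x = \<ominus>\<^bsub>M\<^esub> x"
proof -
  have "(\<ominus>\<^bsub>R\<^esub> \<one>\<^bsub>R\<^esub>) \<odot>\<^bsub>M\<^esub> x \<oplus>\<^bsub>M\<^esub> x = (\<ominus>\<^bsub>R\<^esub> \<one>\<^bsub>R\<^esub> \<oplus>\<^bsub>R\<^esub> \<one>\<^bsub>R\<^esub>) \<odot>\<^bsub>M\<^esub> x"
    using smult_add_scalar[of "\<ominus>\<^bsub>R\<^esub> \<one>\<^bsub>R\<^esub>" "\<one>\<^bsub>R\<^esub>" x] x by (simp add: smult_one)
  also have "\<dots> = \<zero>\<^bsub>M\<^esub>" using x by (simp add: R.l_neg zero_smult)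
  finally show ?thesis using x by (simp add: M.minus_equality smult_closed)
qed

lemma submoduleI:
  assumes "H \<subseteq> carrier M" "\<zero>\<^bsub>M\<^esub> \<in> H"
    and "\<And>x y. \<lbrakk>x \<in> H; y \<in> H\<rbrakk> \<Longrightarrow> x \<oplus>\<^bsub>M\<^esub> y \<in> H"
    and sm: "\<And>r x. \<lbrakk>r \<in> carrier R; x \<in> H\<rbrakk> \<Longrightarrow> r \<odot>\<^bsub>M\<^esub> x \<in> H"
  shows "submodule H R M"
proof -
  have "\<ominus>\<^bsub>M\<^esub> x \<in> H" if "x \<in> H" for x
    using sm[of "\<ominus>\<^bsub>R\<^esub> \<one>\<^bsub>R\<^esub>" x] that assms(1) by (simp add: minus_one_smult subset_iff)
  then have "subgroup H (add_monoid M)"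
    using assms by (intro M.add.subgroupI) (auto simp: a_inv_def)
  then show ?thesis using sm by (intro submodule.intro submodule_axioms.intro)
qed

end

section \<open>The ring of endomorphisms preserving \<open>A\<close>\<close>

locale sequence_endo = right_module R M
  for R :: "('r, 'k) ring_scheme" and M :: "('r, 'b, 'm) module_scheme" +
  fixes A :: "'b set"
  assumes submodule_A: "submodule A R M"
begin

abbreviation E :: "('b \<Rightarrow> 'b) ring" where "E \<equiv> E_ring R M A"

sublocale A: additive_subgroup A M
  by (rule submodule_imp_additive_subgroup) (rule submodule_A)

lemma E_mem_iff:
  "f \<in> carrier E \<longleftrightarrow> f \<in> carrier (End_ring R M) \<and> (\<forall>x\<in>A. f x \<in> A)"
  by (auto simp: E_ring_def)

lemma E_ops:
  "f \<otimes>\<^bsub>E\<^esub> g = (\<lambda>x\<in>carrier M. f (g x))" "\<one>\<^bsub>E\<^esub> = (\<lambda>x\<in>carrier M. x)"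
  "f \<oplus>\<^bsub>E\<^esub> g = (\<lambda>x\<in>carrier M. f x \<oplus>\<^bsub>M\<^esub> g x)" "\<zero>\<^bsub>E\<^esub> = (\<lambda>x\<in>carrier M. \<zero>\<^bsub>M\<^esub>)"
  by (auto simp: E_ring_def End_ring_def compose_def)

lemma E_apply:
  assumes "x \<in> carrier M"
  shows "(f \<otimes>\<^bsub>E\<^esub> g) x = f (g x)" "\<one>\<^bsub>E\<^esub> x = x" "(f \<oplus>\<^bsub>E\<^esub> g) x = f x \<oplus>\<^bsub>M\<^esub> g x" "\<zero>\<^bsub>E\<^esub> x = \<zero>\<^bsub>M\<^esub>"
  using assms by (simp_all add: E_ops)

lemma
  assumes "f \<in> carrier E"
  shows E_closed: "x \<in> carrier M \<Longrightarrow> f x \<in> carrier M"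
    and E_add: "\<lbrakk>x \<in> carrier M; y \<in> carrier M\<rbrakk> \<Longrightarrow> f (x \<oplus>\<^bsub>M\<^esub> y) = f x \<oplus>\<^bsub>M\<^esub> f y"
    and E_smult: "\<lbrakk>r \<in> carrier R; x \<in> carrier M\<rbrakk> \<Longrightarrow> f (r \<odot>\<^bsub>M\<^esub> x) = r \<odot>\<^bsub>M\<^esub> f x"
    and E_extensional: "f \<in> extensional (carrier M)"
    and E_stable: "x \<in> A \<Longrightarrow> f x \<in> A"
  using assms by (auto simp: E_ring_def End_ring_def module_endo_def hom_def)

lemma E_zero: "f \<in> carrier E \<Longrightarrow> f \<zero>\<^bsub>M\<^esub> = \<zero>\<^bsub>M\<^esub>"
  using E_add[of f "\<zero>\<^bsub>M\<^esub>" "\<zero>\<^bsub>M\<^esub>"] E_closed[of f "\<zero>\<^bsub>M\<^esub>"]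
  by (metis M.add.r_cancel_one' M.r_zero M.zero_closed)

lemma E_minus:
  assumes f: "f \<in> carrier E" and x: "x \<in> carrier M"
  shows "f (\<ominus>\<^bsub>M\<^esub> x) = \<ominus>\<^bsub>M\<^esub> f x"
  using E_smult[OF f _ x, of "\<ominus>\<^bsub>R\<^esub> \<one>\<^bsub>R\<^esub>"] x E_closed[OF f x] by (simp add: minus_one_smult)

lemma E_memI:
  assumes "\<And>x. x \<in> carrier M \<Longrightarrow> f x \<in> carrier M"
    and "\<And>x y. \<lbrakk>x \<in> carrier M; y \<in> carrier M\<rbrakk> \<Longrightarrow> f (x \<oplus>\<^bsub>M\<^esub> y) = f x \<oplus>\<^bsub>M\<^esub> f y"
    and "\<And>r x. \<lbrakk>r \<in> carrier R; x \<in> carrier M\<rbrakk> \<Longrightarrow> f (r \<odot>\<^bsub>M\<^esub> x) = r \<odot>\<^bsub>M\<^esub> f x"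
    and "\<And>x. x \<in> A \<Longrightarrow> f x \<in> A"
  shows "(\<lambda>x\<in>carrier M. f x) \<in> carrier E"
  using assms A.a_Hcarr
  by (auto simp: E_ring_def End_ring_def module_endo_def hom_def smult_closed)

lemma E_eqI:
  "\<lbrakk>f \<in> carrier E; g \<in> carrier E; \<And>x. x \<in> carrier M \<Longrightarrow> f x = g x\<rbrakk> \<Longrightarrow> f = g"
  by (meson E_extensional extensionalityI)

sublocale E: ring E
proof -
  interpret End: ring "End_ring R M" by (rule End_ring_ring)
  let ?C = "carrier E"
  have ops: "f \<otimes>\<^bsub>End_ring R M\<^esub> g = f \<otimes>\<^bsub>E\<^esub> g" "f \<oplus>\<^bsub>End_ring R M\<^esub> g = f \<oplus>\<^bsub>E\<^esub> g"
    "\<one>\<^bsub>End_ring R M\<^esub> = \<one>\<^bsub>E\<^esub>" for f g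
    by (simp_all add: E_ring_def)
  have sub: "subring ?C (End_ring R M)"
  proof (rule End.subringI)
    show "?C \<subseteq> carrier (End_ring R M)" by (auto simp: E_mem_iff)
    show "\<one>\<^bsub>End_ring R M\<^esub> \<in> ?C"
      unfolding ops E_ops by (rule E_memI) simp_all
    fix f assume f: "f \<in> ?C"
    then have fE: "f \<in> carrier (End_ring R M)" by (simp add: E_mem_iff)
    have nfE: "\<ominus>\<^bsub>End_ring R M\<^esub> f \<in> carrier (End_ring R M)" using fE by simp
    \<comment> \<open>The negative in \<open>End_ring R M\<close> is given only abstractly.
      Evaluating the identity that it adds with \<open>f\<close> to zero at \<open>x\<close>
      identifies it pointwise, whence it preserves \<open>A\<close>.\<close>
    have "(\<ominus>\<^bsub>End_ring R M\<^esub> f) x = \<ominus>\<^bsub>M\<^esub> f x" if x: "x \<in> carrier M" for x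
    proof -
      have "(\<ominus>\<^bsub>End_ring R M\<^esub> f) x \<oplus>\<^bsub>M\<^esub> f x = (\<ominus>\<^bsub>End_ring R M\<^esub> f \<oplus>\<^bsub>End_ring R M\<^esub> f) x"
        using x by (simp add: ops E_apply)
      also have "\<dots> = \<zero>\<^bsub>M\<^esub>" using x by (simp only: End.l_neg[OF fE]) (simp add: End_ring_def)
      finally have "(\<ominus>\<^bsub>End_ring R M\<^esub> f) x \<oplus>\<^bsub>M\<^esub> f x = \<zero>\<^bsub>M\<^esub>" .
      moreover have "(\<ominus>\<^bsub>End_ring R M\<^esub> f) x \<in> carrier M"
        using nfE x by (auto simp: End_ring_def module_endo_def hom_def)
      ultimately show ?thesis using E_closed[OF f x] by (simp add: M.minus_equality)
    qed
    then show "\<ominus>\<^bsub>End_ring R M\<^esub> f \<in> ?C"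
      using nfE E_stable[OF f] A.a_Hcarr by (simp add: E_mem_iff)
  next
    fix f g assume fg: "f \<in> ?C" "g \<in> ?C"
    show "f \<otimes>\<^bsub>End_ring R M\<^esub> g \<in> ?C"
      unfolding ops E_ops by (rule E_memI) (simp_all add: fg E_closed E_add E_smult E_stable)
    show "f \<oplus>\<^bsub>End_ring R M\<^esub> g \<in> ?C"
      unfolding ops E_ops
      by (rule E_memI) (simp_all add: fg E_closed E_add E_smult E_stable M.a_ac smult_add_vector)
  qed
  have "E = End_ring R M\<lparr>carrier := ?C\<rparr>" by (simp add: E_ring_def)
  then show "ring E" using End.subring_is_ring[OF sub] by simp
qed

text \<open>Bijectivity alone gives an inverse in the full endomorphism ring. That this inverse
  preserves \<open>A\<close> comes from \<open>f\<close> mapping \<open>A\<close> onto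
  \<open>A\<close> and not merely into it.\<close>

lemma bij_imp_unit:
  assumes f: "f \<in> carrier E" and bij: "bij_betw f (carrier M) (carrier M)" and A: "f ` A = A"
  shows "f \<in> Units E"
proof -
  define g where "g = (\<lambda>x\<in>carrier M. the_inv_into (carrier M) f x)"
  have inj: "inj_on f (carrier M)" and surj: "f ` carrier M = carrier M"
    using bij by (auto simp: bij_betw_def)
  have gf: "the_inv_into (carrier M) f (f x) = x" if "x \<in> carrier M" for x
    using the_inv_into_f_f[OF inj that] .
  have fg: "f (the_inv_into (carrier M) f x) = x" if "x \<in> carrier M" for x
    using f_the_inv_into_f[OF inj] that surj by simp
  have gc: "the_inv_into (carrier M) f x \<in> carrier M" if "x \<in> carrier M" for x
    using the_inv_into_into[OF inj _ subset_refl] that surj by simp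
  have g: "g \<in> carrier E"
    unfolding g_def
  proof (rule E_memI)
    fix x y assume "x \<in> carrier M" "y \<in> carrier M"
    then show "the_inv_into (carrier M) f (x \<oplus>\<^bsub>M\<^esub> y)
        = the_inv_into (carrier M) f x \<oplus>\<^bsub>M\<^esub> the_inv_into (carrier M) f y"
      by (intro the_inv_into_f_eq[OF inj]) (simp_all add: E_add[OF f] gc fg)
  next
    fix r x assume "r \<in> carrier R" "x \<in> carrier M"
    then show "the_inv_into (carrier M) f (r \<odot>\<^bsub>M\<^esub> x) = r \<odot>\<^bsub>M\<^esub> the_inv_into (carrier M) f x"
      by (intro the_inv_into_f_eq[OF inj]) (simp_all add: E_smult[OF f] gc fg smult_closed)
  next
    fix x assume "x \<in> A"
    then obtain a where "a \<in> A" "x = f a" using A by blast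
    then show "the_inv_into (carrier M) f x \<in> A" using gf[of a] A.a_Hcarr by simp
  qed (rule gc)
  have "g \<otimes>\<^bsub>E\<^esub> f = \<one>\<^bsub>E\<^esub>"
    by (rule E_eqI) (simp_all add: f g E_apply, simp add: g_def E_closed[OF f] gf)
  moreover have "f \<otimes>\<^bsub>E\<^esub> g = \<one>\<^bsub>E\<^esub>"
    by (rule E_eqI) (simp_all add: f g E_apply, simp add: g_def fg)
  ultimately show ?thesis using f g unfolding Units_def by blast
qed

end

text \<open>
  The assumption \<open>chain\<close> says that the quotient \<open>K/H\<close> is uniserial; no module structure on
  \<open>K/H\<close> is needed.
\<close>

locale uniserial_section = sequence_endo +
  fixes H K :: "'c set"
  assumes submodule_H: "submodule H R M" and submodule_K: "submodule K R M"
    and H_psubset_K: "H \<subset> K"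
    and stable_H: "\<lbrakk>f \<in> carrier E; x \<in> H\<rbrakk> \<Longrightarrow> f x \<in> H"
    and stable_K: "\<lbrakk>f \<in> carrier E; x \<in> K\<rbrakk> \<Longrightarrow> f x \<in> K"
    and chain: "\<lbrakk>submodule L R M; H \<subseteq> L; L \<subseteq> K; submodule L' R M; H \<subseteq> L'; L' \<subseteq> K\<rbrakk>
      \<Longrightarrow> L \<subseteq> L' \<or> L' \<subseteq> L"
begin

sublocale H: additive_subgroup H M
  by (rule submodule_imp_additive_subgroup) (rule submodule_H)

sublocale K: additive_subgroup K M
  by (rule submodule_imp_additive_subgroup) (rule submodule_K)

text \<open>For \<open>f\<close> in \<open>E\<close>, the kernel and the image of the map induced on
  \<open>K/H\<close> are represented by their full preimages in \<open>K\<close>. These are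
  submodules between \<open>H\<close> and \<open>K\<close>, to which \<open>chain\<close>
  applies.\<close>

definition ker_section :: "('c \<Rightarrow> 'c) \<Rightarrow> 'c set"
  where "ker_section f = {x \<in> K. f x \<in> H}"

definition im_section :: "('c \<Rightarrow> 'c) \<Rightarrow> 'c set"
  where "im_section f = {f x \<oplus>\<^bsub>M\<^esub> h | x h. x \<in> K \<and> h \<in> H}"

definition noninjective :: "('c \<Rightarrow> 'c) set"
  where "noninjective = {f \<in> carrier E. ker_section f \<noteq> H}"

definition nonsurjective :: "('c \<Rightarrow> 'c) set"
  where "nonsurjective = {f \<in> carrier E. im_section f \<noteq> K}"

lemma H_subset_K: "x \<in> H \<Longrightarrow> x \<in> K"
  using H_psubset_K by blast

lemma im_sectionI: "\<lbrakk>x \<in> K; h \<in> H\<rbrakk> \<Longrightarrow> f x \<oplus>\<^bsub>M\<^esub> h \<in> im_section f"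
  by (auto simp: im_section_def)

lemma im_sectionE:
  assumes "y \<in> im_section f"
  obtains x h where "x \<in> K" "h \<in> H" "y = f x \<oplus>\<^bsub>M\<^esub> h"
  using assms by (auto simp: im_section_def)

context
  fixes f assumes f: "f \<in> carrier E"
begin

lemma H_subset_ker: "H \<subseteq> ker_section f"
  using stable_H[OF f] H_subset_K by (auto simp: ker_section_def)

lemma ker_subset_K: "ker_section f \<subseteq> K"
  by (auto simp: ker_section_def)

lemma H_subset_im: "H \<subseteq> im_section f"
proof
  fix h assume h: "h \<in> H"
  then have "f \<zero>\<^bsub>M\<^esub> \<oplus>\<^bsub>M\<^esub> h = h" using E_zero[OF f] H.a_Hcarr by simp
  then show "h \<in> im_section f" using im_sectionI[of "\<zero>\<^bsub>M\<^esub>" h f] h K.zero_closed by simp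
qed

lemma im_subset_K: "im_section f \<subseteq> K"
  using stable_K[OF f] H_subset_K by (auto simp: im_section_def)

lemma submodule_ker: "submodule (ker_section f) R M"
proof (rule submoduleI)
  show "ker_section f \<subseteq> carrier M" using ker_subset_K K.a_subset by (rule subset_trans)
  show "\<zero>\<^bsub>M\<^esub> \<in> ker_section f" using H_subset_ker H.zero_closed by (rule subsetD)
next
  fix x y assume "x \<in> ker_section f" "y \<in> ker_section f"
  then show "x \<oplus>\<^bsub>M\<^esub> y \<in> ker_section f"
    using E_add[OF f] K.a_Hcarr by (simp add: ker_section_def)
next
  fix r x assume "r \<in> carrier R" "x \<in> ker_section f"
  then show "r \<odot>\<^bsub>M\<^esub> x \<in> ker_section f"
    using E_smult[OF f] K.a_Hcarr submodule.smult_closed[OF submodule_K]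
      submodule.smult_closed[OF submodule_H] by (simp add: ker_section_def)
qed

lemma submodule_im: "submodule (im_section f) R M"
proof (rule submoduleI)
  show "im_section f \<subseteq> carrier M" using im_subset_K K.a_subset by (rule subset_trans)
  show "\<zero>\<^bsub>M\<^esub> \<in> im_section f" using H_subset_im H.zero_closed by (rule subsetD)
next
  fix y z assume "y \<in> im_section f" "z \<in> im_section f"
  then obtain x h x' h' where *: "x \<in> K" "h \<in> H" "y = f x \<oplus>\<^bsub>M\<^esub> h"
      "x' \<in> K" "h' \<in> H" "z = f x' \<oplus>\<^bsub>M\<^esub> h'"
    by (elim im_sectionE)
  then have "y \<oplus>\<^bsub>M\<^esub> z = f (x \<oplus>\<^bsub>M\<^esub> x') \<oplus>\<^bsub>M\<^esub> (h \<oplus>\<^bsub>M\<^esub> h')"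
    using E_closed[OF f] by (simp add: E_add[OF f] K.a_Hcarr H.a_Hcarr M.a_ac)
  then show "y \<oplus>\<^bsub>M\<^esub> z \<in> im_section f" using * by (simp add: im_sectionI)
next
  fix r y assume r: "r \<in> carrier R" and "y \<in> im_section f"
  then obtain x h where *: "x \<in> K" "h \<in> H" "y = f x \<oplus>\<^bsub>M\<^esub> h"
    by (elim im_sectionE)
  then have "r \<odot>\<^bsub>M\<^esub> y = f (r \<odot>\<^bsub>M\<^esub> x) \<oplus>\<^bsub>M\<^esub> r \<odot>\<^bsub>M\<^esub> h"
    using r E_closed[OF f] by (simp add: E_smult[OF f] K.a_Hcarr H.a_Hcarr smult_add_vector)
  then show "r \<odot>\<^bsub>M\<^esub> y \<in> im_section f"
    using * r submodule.smult_closed[OF submodule_K] submodule.smult_closed[OF submodule_H]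
    by (simp add: im_sectionI)
qed

end

lemma ker_chain:
  "\<lbrakk>f \<in> carrier E; g \<in> carrier E\<rbrakk>
    \<Longrightarrow> ker_section f \<subseteq> ker_section g \<or> ker_section g \<subseteq> ker_section f"
  by (intro chain submodule_ker H_subset_ker ker_subset_K)

lemma im_chain:
  "\<lbrakk>f \<in> carrier E; g \<in> carrier E\<rbrakk>
    \<Longrightarrow> im_section f \<subseteq> im_section g \<or> im_section g \<subseteq> im_section f"
  by (intro chain submodule_im H_subset_im im_subset_K)

section \<open>Endomorphisms inducing a noninjective map on \<open>K/H\<close>\<close>

lemma noninjective_iff:
  "f \<in> noninjective \<longleftrightarrow> f \<in> carrier E \<and> (\<exists>x\<in>K. x \<notin> H \<and> f x \<in> H)"
  using H_subset_ker[of f] unfolding noninjective_def ker_section_def by blast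

lemma ker_add:
  assumes "f \<in> carrier E" "g \<in> carrier E"
  shows "ker_section f \<inter> ker_section g \<subseteq> ker_section (f \<oplus>\<^bsub>E\<^esub> g)"
  by (auto simp: ker_section_def E_apply K.a_Hcarr)

text \<open>For sums, two comparable kernels intersect in the smaller one, which still exceeds
  \<open>H\<close> and is killed modulo \<open>H\<close> by the sum. Multiplying on the left
  preserves any witness of noninjectivity; multiplying on the right requires comparing an image with
  a kernel.\<close>

lemma ideal_noninjective: "ideal noninjective E"
proof (rule idealI[OF E.ring_axioms])
  have mult: "f \<otimes>\<^bsub>E\<^esub> g \<in> noninjective" if f: "f \<in> carrier E" and g: "g \<in> noninjective" for f g
  proof -
    obtain x where x: "x \<in> K" "x \<notin> H" "g x \<in> H" and gE: "g \<in> carrier E"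
      using g by (auto simp: noninjective_iff)
    have "(f \<otimes>\<^bsub>E\<^esub> g) x \<in> H" using stable_H[OF f x(3)] x(1) by (simp add: E_apply K.a_Hcarr)
    then show ?thesis using x f gE by (auto simp: noninjective_iff)
  qed
  then show "\<And>f g. \<lbrakk>f \<in> noninjective; g \<in> carrier E\<rbrakk> \<Longrightarrow> g \<otimes>\<^bsub>E\<^esub> f \<in> noninjective"
    by simp
  show "subgroup noninjective (add_monoid E)"
  proof (rule E.add.subgroupI)
    show "noninjective \<subseteq> carrier E" by (auto simp: noninjective_def)
    obtain x where "x \<in> K" "x \<notin> H" using H_psubset_K by blast
    then have "\<zero>\<^bsub>E\<^esub> \<in> noninjective" by (auto simp: noninjective_iff E_apply K.a_Hcarr)
    then show "noninjective \<noteq> {}" by blast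
  next
    fix f assume f: "f \<in> noninjective"
    then have fE: "f \<in> carrier E" by (simp add: noninjective_iff)
    have "\<ominus>\<^bsub>E\<^esub> f = \<ominus>\<^bsub>E\<^esub> \<one>\<^bsub>E\<^esub> \<otimes>\<^bsub>E\<^esub> f" using fE by (simp add: E.l_minus)
    then show "\<ominus>\<^bsub>E\<^esub> f \<in> noninjective" using mult[OF E.a_inv_closed[OF E.one_closed] f] by simp
  next
    fix f g assume fg: "f \<in> noninjective" "g \<in> noninjective"
    then have E: "f \<in> carrier E" "g \<in> carrier E" by (auto simp: noninjective_iff)
    have "H \<subset> ker_section f \<inter> ker_section g"
      using ker_chain[OF E] fg H_subset_ker[OF E(1)] H_subset_ker[OF E(2)]
      unfolding noninjective_def by blast
    then have "ker_section (f \<oplus>\<^bsub>E\<^esub> g) \<noteq> H" using ker_add[OF E] by blast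
    then show "f \<oplus>\<^bsub>E\<^esub> g \<in> noninjective"
      using E by (simp add: noninjective_def)
  qed
  show "f \<otimes>\<^bsub>E\<^esub> g \<in> noninjective" if f: "f \<in> noninjective" and g: "g \<in> carrier E" for f g
  proof -
    have fE: "f \<in> carrier E" using f by (simp add: noninjective_iff)
    have comp: "(f \<otimes>\<^bsub>E\<^esub> g) x = f (g x)" if "x \<in> K" for x using that by (simp add: E_apply K.a_Hcarr)
    \<comment> \<open>If the image of \<open>g\<close> lies in the kernel of \<open>f\<close>, any
      \<open>x\<close> outside \<open>H\<close> will do. Otherwise the image contains that kernel,
      and a kernel element \<open>y\<close> outside \<open>H\<close> equals some \<open>g x\<close>
      up to an element of \<open>H\<close>; such an \<open>x\<close> is outside \<open>H\<close>
      because \<open>g\<close> preserves \<open>H\<close>.\<close>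
    have "\<exists>x\<in>K. x \<notin> H \<and> g x \<in> ker_section f"
    proof (cases "im_section g \<subseteq> ker_section f")
      case True
      obtain x where x: "x \<in> K" "x \<notin> H" using H_psubset_K by blast
      have "g x \<oplus>\<^bsub>M\<^esub> \<zero>\<^bsub>M\<^esub> \<in> ker_section f" using subsetD[OF True im_sectionI[OF x(1) H.zero_closed]] .
      then show ?thesis using x E_closed[OF g] by (auto simp: K.a_Hcarr)
    next
      case False
      then have sub: "ker_section f \<subseteq> im_section g"
        using chain[OF submodule_im[OF g] H_subset_im[OF g] im_subset_K[OF g]
            submodule_ker[OF fE] H_subset_ker[OF fE] ker_subset_K[OF fE]] by blast
      obtain y where y: "y \<in> ker_section f" "y \<notin> H"
        using f H_subset_ker[OF fE] unfolding noninjective_def by blast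
      obtain x h where x: "x \<in> K" "h \<in> H" "y = g x \<oplus>\<^bsub>M\<^esub> h"
        using subsetD[OF sub y(1)] by (rule im_sectionE)
      have carr: "g x \<in> carrier M" "h \<in> carrier M" using x E_closed[OF g] K.a_Hcarr H.a_Hcarr by auto
      have "g x \<notin> H" using y(2) x by auto
      then have "x \<notin> H" using stable_H[OF g] by blast
      have "h \<in> ker_section f" using H_subset_ker[OF fE] x(2) by (rule subsetD)
      interpret ker: additive_subgroup "ker_section f" M
        by (rule submodule_imp_additive_subgroup) (rule submodule_ker[OF fE])
      have "y \<oplus>\<^bsub>M\<^esub> \<ominus>\<^bsub>M\<^esub> h \<in> ker_section f"
        by (intro ker.a_closed ker.a_inv_closed y(1)) fact
      moreover have "y \<oplus>\<^bsub>M\<^esub> \<ominus>\<^bsub>M\<^esub> h = g x" using carr x(3) by (simp add: M.a_assoc M.r_neg)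
      ultimately show ?thesis using x(1) \<open>x \<notin> H\<close> by auto
    qed
    then obtain x where x: "x \<in> K" "x \<notin> H" "g x \<in> ker_section f" by blast
    then have "(f \<otimes>\<^bsub>E\<^esub> g) x \<in> H" by (simp add: comp ker_section_def)
    then show ?thesis using x fE g by (auto simp: noninjective_iff)
  qed
qed

text \<open>Suppose the product \<open>f g\<close> sends some \<open>x\<close> outside
  \<open>H\<close> into \<open>H\<close>. Then \<open>x\<close> is a witness for \<open>g\<close> if
  \<open>g x\<close> is in \<open>H\<close>, and otherwise \<open>g x\<close> is a witness for
  \<open>f\<close>.\<close>

lemma completely_prime_noninjective: "completely_prime_ideal noninjective E"
proof (intro completely_prime_ideal.intro completely_prime_ideal_axioms.intro ideal_noninjective)
  have "\<one>\<^bsub>E\<^esub> \<notin> noninjective" by (auto simp: noninjective_iff E_apply K.a_Hcarr)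
  then show "noninjective \<noteq> carrier E" using E.one_closed by metis
next
  fix f g assume E: "f \<in> carrier E" "g \<in> carrier E" and "f \<otimes>\<^bsub>E\<^esub> g \<in> noninjective"
  then obtain x where x: "x \<in> K" "x \<notin> H" "f (g x) \<in> H"
    by (auto simp: noninjective_iff E_apply K.a_Hcarr)
  then show "f \<in> noninjective \<or> g \<in> noninjective"
    using E stable_K[OF E(2) x(1)] unfolding noninjective_iff by blast
qed

section \<open>Endomorphisms inducing a nonsurjective map on \<open>K/H\<close>\<close>

lemma im_mult_subset:
  assumes E: "f \<in> carrier E" "g \<in> carrier E"
  shows "im_section (f \<otimes>\<^bsub>E\<^esub> g) \<subseteq> im_section f"
proof
  fix y assume "y \<in> im_section (f \<otimes>\<^bsub>E\<^esub> g)"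
  then obtain x h where "x \<in> K" "h \<in> H" "y = f (g x) \<oplus>\<^bsub>M\<^esub> h"
    by (elim im_sectionE) (simp add: E_apply K.a_Hcarr)
  then show "y \<in> im_section f" using im_sectionI[OF stable_K[OF E(2)]] by simp
qed

lemma im_add:
  assumes E: "f \<in> carrier E" "g \<in> carrier E" and sub: "im_section f \<subseteq> im_section g"
  shows "im_section (f \<oplus>\<^bsub>E\<^esub> g) \<subseteq> im_section g"
proof
  interpret im: additive_subgroup "im_section g" M
    by (rule submodule_imp_additive_subgroup) (rule submodule_im[OF E(2)])
  fix y assume "y \<in> im_section (f \<oplus>\<^bsub>E\<^esub> g)"
  then obtain x h where x: "x \<in> K" "h \<in> H" "y = (f x \<oplus>\<^bsub>M\<^esub> g x) \<oplus>\<^bsub>M\<^esub> h"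
    by (elim im_sectionE) (simp add: E_apply K.a_Hcarr)
  have carr: "f x \<in> carrier M" "g x \<in> carrier M" "h \<in> carrier M"
    using x E_closed[OF E(1)] E_closed[OF E(2)] K.a_Hcarr H.a_Hcarr by auto
  have "f x \<oplus>\<^bsub>M\<^esub> \<zero>\<^bsub>M\<^esub> \<in> im_section g"
    using sub im_sectionI[OF x(1) H.zero_closed] by (rule subsetD)
  then have "(f x \<oplus>\<^bsub>M\<^esub> \<zero>\<^bsub>M\<^esub>) \<oplus>\<^bsub>M\<^esub> (g x \<oplus>\<^bsub>M\<^esub> h) \<in> im_section g"
    using im_sectionI[OF x(1,2)] by (rule im.a_closed)
  then show "y \<in> im_section g" using carr x(3) by (simp add: M.a_assoc)
qed

text \<open>Dual to the noninjective case: the image of a sum lies in the larger of two comparable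
  images, and multiplying on the right only shrinks the image. Multiplying on the left is the case
  that compares an image with a kernel.\<close>

lemma ideal_nonsurjective: "ideal nonsurjective E"
proof (rule idealI[OF E.ring_axioms])
  have mult: "f \<otimes>\<^bsub>E\<^esub> g \<in> nonsurjective" if f: "f \<in> nonsurjective" and g: "g \<in> carrier E" for f g
  proof -
    have fE: "f \<in> carrier E" using f by (simp add: nonsurjective_def)
    then have "im_section (f \<otimes>\<^bsub>E\<^esub> g) \<noteq> K"
      using im_mult_subset[OF fE g] im_subset_K[OF fE] f unfolding nonsurjective_def by blast
    then show ?thesis using fE g by (simp add: nonsurjective_def)
  qed
  then show "\<And>f g. \<lbrakk>f \<in> nonsurjective; g \<in> carrier E\<rbrakk> \<Longrightarrow> f \<otimes>\<^bsub>E\<^esub> g \<in> nonsurjective"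
    by simp
  show "subgroup nonsurjective (add_monoid E)"
  proof (rule E.add.subgroupI)
    show "nonsurjective \<subseteq> carrier E" by (auto simp: nonsurjective_def)
    have "im_section \<zero>\<^bsub>E\<^esub> \<subseteq> H"
      by (auto simp: E_apply K.a_Hcarr H.a_Hcarr elim!: im_sectionE)
    then have "\<zero>\<^bsub>E\<^esub> \<in> nonsurjective"
      using H_psubset_K unfolding nonsurjective_def by auto
    then show "nonsurjective \<noteq> {}" by blast
  next
    fix f assume f: "f \<in> nonsurjective"
    then have fE: "f \<in> carrier E" by (simp add: nonsurjective_def)
    have "\<ominus>\<^bsub>E\<^esub> f = f \<otimes>\<^bsub>E\<^esub> \<ominus>\<^bsub>E\<^esub> \<one>\<^bsub>E\<^esub>" using fE by (simp add: E.r_minus)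
    then show "\<ominus>\<^bsub>E\<^esub> f \<in> nonsurjective" using mult[OF f E.a_inv_closed[OF E.one_closed]] by simp
  next
    fix f g assume fg: "f \<in> nonsurjective" "g \<in> nonsurjective"
    then have E: "f \<in> carrier E" "g \<in> carrier E" by (auto simp: nonsurjective_def)
    have "im_section (f \<oplus>\<^bsub>E\<^esub> g) \<noteq> K"
    proof (cases "im_section f \<subseteq> im_section g")
      case True
      then show ?thesis
        using im_add[OF E True] fg(2) im_subset_K[OF E(2)] unfolding nonsurjective_def by blast
    next
      case False
      then have "im_section g \<subseteq> im_section f" using im_chain[OF E] by blast
      then have "im_section (g \<oplus>\<^bsub>E\<^esub> f) \<noteq> K"
        using im_add[OF E(2,1)] fg(1) im_subset_K[OF E(1)] unfolding nonsurjective_def by blast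
      then show ?thesis using E.a_comm[OF E] by simp
    qed
    then show "f \<oplus>\<^bsub>E\<^esub> g \<in> nonsurjective"
      using E by (simp add: nonsurjective_def)
  qed
  show "f \<otimes>\<^bsub>E\<^esub> g \<in> nonsurjective" if g: "g \<in> nonsurjective" and f: "f \<in> carrier E" for f g
  proof (rule ccontr)
    have gE: "g \<in> carrier E" using g by (simp add: nonsurjective_def)
    assume "f \<otimes>\<^bsub>E\<^esub> g \<notin> nonsurjective"
    then have surj: "im_section (f \<otimes>\<^bsub>E\<^esub> g) = K" using f gE by (simp add: nonsurjective_def)
    \<comment> \<open>Surjectivity of \<open>f g\<close> modulo \<open>H\<close> writes
      \<open>K\<close> as the sum of the image of \<open>g\<close> and the kernel of
      \<open>f\<close>: subtract from \<open>x\<close> an element \<open>g z\<close> with the same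
      value under \<open>f\<close> modulo \<open>H\<close>.\<close>
    have "\<exists>n\<in>im_section g. \<exists>l\<in>ker_section f. x = n \<oplus>\<^bsub>M\<^esub> l" if x: "x \<in> K" for x
    proof -
      have "f x \<in> im_section (f \<otimes>\<^bsub>E\<^esub> g)" using stable_K[OF f x] surj by simp
      then obtain z h where z: "z \<in> K" "h \<in> H" "f x = f (g z) \<oplus>\<^bsub>M\<^esub> h"
        by (elim im_sectionE) (simp add: E_apply K.a_Hcarr)
      have carr: "x \<in> carrier M" "g z \<in> carrier M" "h \<in> carrier M"
        using x z E_closed[OF gE] K.a_Hcarr H.a_Hcarr by auto
      have gz: "g z \<in> im_section g"
        using im_sectionI[OF z(1) H.zero_closed, of g] carr by simp
      have "f (\<ominus>\<^bsub>M\<^esub> g z \<oplus>\<^bsub>M\<^esub> x) = \<ominus>\<^bsub>M\<^esub> f (g z) \<oplus>\<^bsub>M\<^esub> (f (g z) \<oplus>\<^bsub>M\<^esub> h)"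
        using carr z(3) by (simp add: E_add[OF f] E_minus[OF f])
      also have "\<dots> = h" using carr E_closed[OF f] by (simp add: M.r_neg1)
      finally have "\<ominus>\<^bsub>M\<^esub> g z \<oplus>\<^bsub>M\<^esub> x \<in> ker_section f"
        using z(1,2) x stable_K[OF gE] by (simp add: ker_section_def)
      moreover have "x = g z \<oplus>\<^bsub>M\<^esub> (\<ominus>\<^bsub>M\<^esub> g z \<oplus>\<^bsub>M\<^esub> x)"
        using carr by (simp add: M.r_neg2)
      ultimately show ?thesis using gz by blast
    qed
    note decomp = this
    interpret im: additive_subgroup "im_section g" M
      by (rule submodule_imp_additive_subgroup) (rule submodule_im[OF gE])
    interpret ker: additive_subgroup "ker_section f" M
      by (rule submodule_imp_additive_subgroup) (rule submodule_ker[OF f])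
    \<comment> \<open>By comparability one of the two summands is all of \<open>K\<close>. Either
      \<open>f\<close> induces the zero map, so that \<open>f g\<close> cannot be surjective on the
      nonzero \<open>K/H\<close>, or \<open>g\<close> is surjective, contrary to its choice.\<close>
    consider "im_section g \<subseteq> ker_section f" | "ker_section f \<subseteq> im_section g"
      using chain[OF submodule_im[OF gE] H_subset_im[OF gE] im_subset_K[OF gE]
            submodule_ker[OF f] H_subset_ker[OF f] ker_subset_K[OF f]] by blast
    then show False
    proof cases
      case 1
      have "K \<subseteq> ker_section f"
      proof
        fix x assume "x \<in> K"
        then obtain n l where "n \<in> im_section g" "l \<in> ker_section f" "x = n \<oplus>\<^bsub>M\<^esub> l"
          using decomp by metis
        then show "x \<in> ker_section f" using subsetD[OF 1] ker.a_closed by simp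
      qed
      then have fK: "f x \<in> H" if "x \<in> K" for x using that by (auto simp: ker_section_def)
      have "im_section (f \<otimes>\<^bsub>E\<^esub> g) \<subseteq> H"
      proof
        fix y assume "y \<in> im_section (f \<otimes>\<^bsub>E\<^esub> g)"
        then obtain x h where "x \<in> K" "h \<in> H" "y = f (g x) \<oplus>\<^bsub>M\<^esub> h"
          by (elim im_sectionE) (simp add: E_apply K.a_Hcarr)
        then show "y \<in> H" using fK[OF stable_K[OF gE]] by simp
      qed
      then show False using surj H_psubset_K by blast
    next
      case 2
      have "K \<subseteq> im_section g"
      proof
        fix x assume "x \<in> K"
        then obtain n l where "n \<in> im_section g" "l \<in> ker_section f" "x = n \<oplus>\<^bsub>M\<^esub> l"
          using decomp by metis
        then show "x \<in> im_section g" using subsetD[OF 2] im.a_closed by simp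
      qed
      then show False using g im_subset_K[OF gE] unfolding nonsurjective_def by blast
    qed
  qed
qed

text \<open>By contraposition, composites of surjective induced maps are surjective: the correction
  term in \<open>H\<close> left by \<open>g\<close> is carried into \<open>H\<close> again by
  \<open>f\<close> and absorbed there.\<close>

lemma completely_prime_nonsurjective: "completely_prime_ideal nonsurjective E"
proof (intro completely_prime_ideal.intro completely_prime_ideal_axioms.intro ideal_nonsurjective)
  have "K \<subseteq> im_section \<one>\<^bsub>E\<^esub>"
  proof
    fix x assume x: "x \<in> K"
    then have "\<one>\<^bsub>E\<^esub> x \<oplus>\<^bsub>M\<^esub> \<zero>\<^bsub>M\<^esub> = x" by (simp add: E_apply K.a_Hcarr)
    then show "x \<in> im_section \<one>\<^bsub>E\<^esub>" using im_sectionI[OF x H.zero_closed, of "\<one>\<^bsub>E\<^esub>"] by simp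
  qed
  then have "\<one>\<^bsub>E\<^esub> \<notin> nonsurjective"
    using im_subset_K[OF E.one_closed] unfolding nonsurjective_def by blast
  then show "nonsurjective \<noteq> carrier E" using E.one_closed by metis
next
  fix f g assume E: "f \<in> carrier E" "g \<in> carrier E" and fg: "f \<otimes>\<^bsub>E\<^esub> g \<in> nonsurjective"
  show "f \<in> nonsurjective \<or> g \<in> nonsurjective"
  proof (rule ccontr)
    assume "\<not> ?thesis"
    then have surj: "im_section f = K" "im_section g = K" using E by (auto simp: nonsurjective_def)
    have "K \<subseteq> im_section (f \<otimes>\<^bsub>E\<^esub> g)"
    proof
      fix y assume "y \<in> K"
      then have "y \<in> im_section f" by (simp only: surj)
      then obtain x h where x: "x \<in> K" "h \<in> H" "y = f x \<oplus>\<^bsub>M\<^esub> h" by (rule im_sectionE)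
      then have "x \<in> im_section g" by (simp only: surj)
      then obtain z h' where z: "z \<in> K" "h' \<in> H" "x = g z \<oplus>\<^bsub>M\<^esub> h'" by (rule im_sectionE)
      have carr: "g z \<in> carrier M" "h \<in> carrier M" "h' \<in> carrier M"
        using x z E_closed[OF E(2)] K.a_Hcarr H.a_Hcarr by auto
      have "y = (f \<otimes>\<^bsub>E\<^esub> g) z \<oplus>\<^bsub>M\<^esub> (f h' \<oplus>\<^bsub>M\<^esub> h)"
        using x(3) z carr E_closed[OF E(1)]
        by (simp add: E_apply K.a_Hcarr E_add[OF E(1)] M.a_assoc)
      moreover have "f h' \<oplus>\<^bsub>M\<^esub> h \<in> H" using stable_H[OF E(1) z(2)] x(2) by (rule H.a_closed)
      ultimately show "y \<in> im_section (f \<otimes>\<^bsub>E\<^esub> g)" using im_sectionI[OF z(1)] by simp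
    qed
    then show False
      using fg im_subset_K[OF E.m_closed[OF E]] unfolding nonsurjective_def by blast
  qed
qed

end

section \<open>The lower and the upper section of a short exact sequence\<close>

context sequence_endo
begin

lemma uniserial_submodule_chain:
  assumes uni: "uniserial R (M\<lparr>carrier := A\<rparr>)"
    and L: "submodule L R M" "L \<subseteq> A" "submodule L' R M" "L' \<subseteq> A"
  shows "L \<subseteq> L' \<or> L' \<subseteq> L"
proof -
  have "submodule N R (M\<lparr>carrier := A\<rparr>)" if N: "submodule N R M" "N \<subseteq> A" for N
  proof (intro submodule.intro submodule_axioms.intro)
    show "subgroup N (add_monoid (M\<lparr>carrier := A\<rparr>))"
      using M.add.subgroup_incl[OF submodule.axioms(1)[OF N(1)] A.a_subgroup N(2)] by simp
  qed (use submodule.smult_closed[OF N(1)] in simp)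
  then show ?thesis using uni L unfolding uniserial_def by blast
qed

text \<open>The part of the correspondence theorem that transfers comparability: \<open>q\<close>
  sends submodules of \<open>M\<close> to submodules of the quotient, and an inclusion of images
  pulls back as soon as the larger submodule contains \<open>A\<close>, since elements with the same
  coset differ by an element of \<open>A\<close>.\<close>

lemma uniserial_quotient_chain:
  assumes uni: "uniserial R (quotient_module M A)"
    and L: "submodule L R M" "A \<subseteq> L" "submodule L' R M" "A \<subseteq> L'"
  shows "L \<subseteq> L' \<or> L' \<subseteq> L"
proof -
  interpret Q: right_module R "quotient_module M A" by (rule quotient_right_module[OF submodule_A])
  interpret A': abelian_subgroup A M
    by (rule abelian_subgroupI3) (rule A.additive_subgroup_axioms, rule M.abelian_group_axioms)
  define q where "q N = (\<lambda>x. A +>\<^bsub>M\<^esub> x) ` N" for N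
  have sub: "submodule (q N) R (quotient_module M A)" if N: "submodule N R M" for N
  proof -
    interpret N: additive_subgroup N M by (rule submodule_imp_additive_subgroup) (rule N)
    have qI: "A +>\<^bsub>M\<^esub> x \<in> q N" if "x \<in> N" for x using that by (simp add: q_def)
    show ?thesis
    proof (rule Q.submoduleI)
      show "q N \<subseteq> carrier (quotient_module M A)"
        unfolding q_def quotient_module_def A_RCOSETS_def' using N.a_subset by auto
      show "\<zero>\<^bsub>quotient_module M A\<^esub> \<in> q N"
        using qI[OF N.zero_closed] by (simp add: quotient_module_def M.a_coset_add_zero A.a_subset)
    next
      fix u v assume "u \<in> q N" "v \<in> q N"
      then obtain x y where *: "x \<in> N" "y \<in> N" "u = A +>\<^bsub>M\<^esub> x" "v = A +>\<^bsub>M\<^esub> y"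
        by (auto simp: q_def)
      then have "u \<oplus>\<^bsub>quotient_module M A\<^esub> v = A +>\<^bsub>M\<^esub> (x \<oplus>\<^bsub>M\<^esub> y)"
        by (simp add: quotient_module_def A'.a_rcos_sum N.a_Hcarr)
      then show "u \<oplus>\<^bsub>quotient_module M A\<^esub> v \<in> q N" using qI[OF N.a_closed[OF *(1,2)]] by simp
    next
      fix r u assume r: "r \<in> carrier R" and "u \<in> q N"
      then obtain x where *: "x \<in> N" "u = A +>\<^bsub>M\<^esub> x" by (auto simp: q_def)
      then show "r \<odot>\<^bsub>quotient_module M A\<^esub> u \<in> q N"
        using qI[OF submodule.smult_closed[OF N r *(1)]]
        by (simp add: quotient_smult[OF submodule_A r N.a_Hcarr])
    qed
  qed
  have incl: "N \<subseteq> N'" if N: "submodule N R M" "submodule N' R M" "A \<subseteq> N'" and q: "q N \<subseteq> q N'" for N N'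
  proof
    interpret N: additive_subgroup N M by (rule submodule_imp_additive_subgroup) (rule N(1))
    interpret N': additive_subgroup N' M by (rule submodule_imp_additive_subgroup) (rule N(2))
    fix x assume x: "x \<in> N"
    then have "A +>\<^bsub>M\<^esub> x \<in> q N'" using q by (auto simp: q_def)
    then obtain y where y: "y \<in> N'" "A +>\<^bsub>M\<^esub> x = A +>\<^bsub>M\<^esub> y" by (auto simp: q_def)
    have "x \<in> A +>\<^bsub>M\<^esub> y" using A'.a_rcos_self[OF N.a_Hcarr[OF x]] by (simp only: y(2))
    then obtain a where "a \<in> A" "x = a \<oplus>\<^bsub>M\<^esub> y" by (auto simp: a_r_coset_def')
    then show "x \<in> N'" using N'.a_closed[OF _ y(1)] subsetD[OF N(3)] by simp
  qed
  have "q L \<subseteq> q L' \<or> q L' \<subseteq> q L"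
    using uni sub[OF L(1)] sub[OF L(3)] unfolding uniserial_def by blast
  then show ?thesis using incl[OF L(1,3,4)] incl[OF L(3,1,2)] by (elim disjE) simp_all
qed

end

section \<open>The four ideals as ideals of the two sections\<close>

locale uniserial_sequence = sequence_endo +
  assumes A_nonzero: "A \<noteq> {\<zero>\<^bsub>M\<^esub>}" and A_proper: "A \<subset> carrier M"
    and uniserial_A: "uniserial R (M\<lparr>carrier := A\<rparr>)"
    and uniserial_quotient: "uniserial R (quotient_module M A)"
begin

sublocale lower: uniserial_section R M A "{\<zero>\<^bsub>M\<^esub>}" A
proof (intro uniserial_section.intro uniserial_section_axioms.intro sequence_endo_axioms)
  show "submodule {\<zero>\<^bsub>M\<^esub>} R M" by (rule submoduleI) (simp_all add: smult_zero)
  show "{\<zero>\<^bsub>M\<^esub>} \<subset> A" using A_nonzero A.zero_closed by blast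
qed (simp_all add: submodule_A E_stable E_zero uniserial_submodule_chain[OF uniserial_A])

sublocale upper: uniserial_section R M A A "carrier M"
proof (intro uniserial_section.intro uniserial_section_axioms.intro sequence_endo_axioms)
  show "submodule (carrier M) R M" by (rule submoduleI) (simp_all add: smult_closed)
qed (simp_all add: submodule_A A_proper E_stable E_closed uniserial_quotient_chain[OF uniserial_quotient])

text \<open>In the section with \<open>H\<close> zero and \<open>K = A\<close>, landing in
  \<open>H\<close> means vanishing, so \<open>ker_section f\<close> is the part of the kernel inside
  \<open>A\<close>.\<close>

lemma I_ml_eq: "I_ml R M A = lower.noninjective"
proof -
  have "a_kernel M M f \<inter> A = lower.ker_section f" for f
    unfolding a_kernel_def' lower.ker_section_def using A.a_subset by blast
  then show ?thesis unfolding I_ml_def lower.noninjective_def by (simp only:)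
qed

lemma I_el_eq: "I_el R M A = lower.nonsurjective"
proof -
  have "lower.im_section f = f ` A" if "f \<in> carrier E" for f
  proof -
    have eq: "f x \<oplus>\<^bsub>M\<^esub> \<zero>\<^bsub>M\<^esub> = f x" if "x \<in> A" for x
      using E_closed[OF \<open>f \<in> carrier E\<close>] A.a_Hcarr[OF that] by simp
    then show ?thesis unfolding lower.im_section_def image_def by (intro Collect_cong) (simp, metis eq)
  qed
  then have "f ` A \<subset> A \<longleftrightarrow> lower.im_section f \<noteq> A" if "f \<in> carrier E" for f
    using that lower.im_subset_K[OF that] unfolding psubset_eq by simp
  then show ?thesis
    unfolding I_el_def lower.nonsurjective_def by (intro Collect_cong conj_cong refl)
qed

lemma I_mu_eq: "I_mu R M A = upper.noninjective"
proof -
  have "A \<subset> {x \<in> carrier M. f x \<in> A} \<longleftrightarrow> upper.ker_section f \<noteq> A" if "f \<in> carrier E" for f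
    using upper.H_subset_ker[OF that] unfolding upper.ker_section_def by blast
  then show ?thesis
    unfolding I_mu_def upper.noninjective_def by (intro Collect_cong conj_cong refl)
qed

lemma I_eu_eq: "I_eu R M A = upper.nonsurjective"
proof -
  have "f ` carrier M <+>\<^bsub>M\<^esub> A = upper.im_section f" for f
    unfolding set_add_def' upper.im_section_def by blast
  then have "f ` carrier M <+>\<^bsub>M\<^esub> A \<subset> carrier M \<longleftrightarrow> upper.im_section f \<noteq> carrier M"
    if "f \<in> carrier E" for f
    using upper.im_subset_K[OF that] unfolding psubset_eq by simp
  then show ?thesis
    unfolding I_eu_def upper.nonsurjective_def by (intro Collect_cong conj_cong refl)
qed

abbreviation four_ideals :: "('c \<Rightarrow> 'c) set set"
  where "four_ideals \<equiv> {I_ml R M A, I_el R M A, I_mu R M A, I_eu R M A}"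

lemma completely_prime_four_ideals: "P \<in> four_ideals \<Longrightarrow> completely_prime_ideal P E"
  unfolding I_ml_eq I_el_eq I_mu_eq I_eu_eq
  using lower.completely_prime_noninjective lower.completely_prime_nonsurjective
    upper.completely_prime_noninjective upper.completely_prime_nonsurjective by blast

text \<open>The short five lemma by elements: \<open>f\<close> induces bijections on
  \<open>A\<close> and on the quotient by \<open>A\<close>, hence is bijective, and it maps
  \<open>A\<close> onto \<open>A\<close>.\<close>

lemma unit_if_outside_four_ideals:
  assumes f: "f \<in> carrier E" and out: "f \<notin> \<Union>four_ideals"
  shows "f \<in> Units E"
proof (rule bij_imp_unit[OF f])
  have ml: "x = \<zero>\<^bsub>M\<^esub>" if "x \<in> A" "f x = \<zero>\<^bsub>M\<^esub>" for x
    using f out that by (auto simp: I_ml_eq lower.noninjective_iff)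
  have el: "f ` A = A"
    using f out E_stable[OF f] by (auto simp: I_el_def psubset_eq)
  have mu: "x \<in> A" if "x \<in> carrier M" "f x \<in> A" for x
    using f out that by (auto simp: I_mu_eq upper.noninjective_iff)
  have eu: "upper.im_section f = carrier M"
    using f out by (auto simp: I_eu_eq upper.nonsurjective_def)
  show "f ` A = A" by (rule el)
  have inj: "x = y" if xy: "x \<in> carrier M" "y \<in> carrier M" "f x = f y" for x y
  proof -
    have "f (x \<oplus>\<^bsub>M\<^esub> \<ominus>\<^bsub>M\<^esub> y) = \<zero>\<^bsub>M\<^esub>"
      using xy E_closed[OF f] by (simp add: E_add[OF f] E_minus[OF f] M.r_neg)
    \<comment> \<open>The difference is mapped to zero, which lies in \<open>A\<close>; so
      \<open>mu\<close> places it in \<open>A\<close>, where \<open>ml\<close> makes it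
      zero.\<close>
    then have "x \<oplus>\<^bsub>M\<^esub> \<ominus>\<^bsub>M\<^esub> y = \<zero>\<^bsub>M\<^esub>"
      using ml mu[of "x \<oplus>\<^bsub>M\<^esub> \<ominus>\<^bsub>M\<^esub> y"] xy A.zero_closed by simp
    then have "\<ominus>\<^bsub>M\<^esub> (\<ominus>\<^bsub>M\<^esub> y) = x" using M.a_inv_closed[OF xy(2)] xy(1) by (rule M.minus_equality)
    then show ?thesis using xy(2) by simp
  qed
  have "y \<in> f ` carrier M" if "y \<in> carrier M" for y
  proof -
    have "y \<in> upper.im_section f" using that by (simp only: eu)
    \<comment> \<open>Surjectivity modulo \<open>A\<close> leaves an error \<open>a\<close> in
      \<open>A\<close>, which \<open>el\<close> lifts to some \<open>b\<close> in \<open>A\<close>;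
      then \<open>x\<close> corrected by \<open>b\<close> is a preimage of \<open>y\<close>.\<close>
    then obtain x a where x: "x \<in> carrier M" "a \<in> A" "y = f x \<oplus>\<^bsub>M\<^esub> a" by (rule upper.im_sectionE)
    then obtain b where b: "b \<in> A" "a = f b" using el by blast
    then have "y = f (x \<oplus>\<^bsub>M\<^esub> b)" using x by (simp add: E_add[OF f] A.a_Hcarr)
    then show ?thesis using x(1) A.a_Hcarr[OF b(1)] by (intro image_eqI[of y f "x \<oplus>\<^bsub>M\<^esub> b"]) simp_all
  qed
  then show "bij_betw f (carrier M) (carrier M)"
    by (intro bij_betw_imageI inj_onI equalityI subsetI) (auto intro: inj E_closed[OF f])
qed

text \<open>One inclusion is the preceding criterion for units; the other holds because a proper
  ideal contains no unit.\<close>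

lemma units_E_eq: "Units E = carrier E - \<Union>four_ideals"
proof (rule Set.set_eqI)
  fix f
  show "f \<in> Units E \<longleftrightarrow> f \<in> carrier E - \<Union>four_ideals"
  proof
    assume f: "f \<in> Units E"
    have "f \<notin> P" if "P \<in> four_ideals" for P
    proof
      assume "f \<in> P"
      interpret P: completely_prime_ideal P E by (rule completely_prime_four_ideals) (rule that)
      show False
        using P.proper E.right_ideal_with_unit[OF E.ideal_imp_right_ideal[OF P.is_ideal] \<open>f \<in> P\<close> f]
        by (rule notE)
    qed
    then have "f \<notin> \<Union>four_ideals" by (meson UnionE)
    then show "f \<in> carrier E - \<Union>four_ideals" using E.Units_closed[OF f] by (rule DiffI[rotated])
  next
    assume "f \<in> carrier E - \<Union>four_ideals"
    then show "f \<in> Units E" by (elim DiffE) (rule unit_if_outside_four_ideals)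
  qed
qed

sublocale four: semilocal_by_primes E four_ideals
  by (intro semilocal_by_primes.intro semilocal_by_primes_axioms.intro E.ring_axioms
      completely_prime_four_ideals units_E_eq finite.intros insert_not_empty)

end
theorem theorem3p2:
  fixes R :: "('r, 'k) ring_scheme"
    and B :: "('r, 'b, 'm) module_scheme"
    and A :: "'b set"
  assumes "ring R"
    and "right_module R B"
    and "submodule A R B"
    and "A \<subset> carrier B"
    and "A \<noteq> {\<zero>\<^bsub>B\<^esub>}"
    and "uniserial R (B\<lparr>carrier := A\<rparr>)"
    and "uniserial R (quotient_module B A)"
  shows "(\<forall>P \<in> {I_ml R B A, I_el R B A, I_mu R B A, I_eu R B A}.
            completely_prime_ideal P (E_ring R B A))
    \<and> (\<forall>K. right_ideal K (E_ring R B A) \<and> K \<noteq> carrier (E_ring R B A) \<longrightarrow>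
            (\<exists>P \<in> {I_ml R B A, I_el R B A, I_mu R B A, I_eu R B A}. K \<subseteq> P))
    \<and> (\<forall>K. left_ideal K (E_ring R B A) \<and> K \<noteq> carrier (E_ring R B A) \<longrightarrow>
            (\<exists>P \<in> {I_ml R B A, I_el R B A, I_mu R B A, I_eu R B A}. K \<subseteq> P))
    \<and> (\<exists>Ds. 1 \<le> length Ds \<and> length Ds \<le> 4
          \<and> (\<forall>D \<in> set Ds. skew_field D)
          \<and> set Ds \<subseteq> {E_ring R B A Quot I_ml R B A, E_ring R B A Quot I_el R B A,
                        E_ring R B A Quot I_mu R B A, E_ring R B A Quot I_eu R B A}
          \<and> E_ring R B A Quot jacobson_radical (E_ring R B A) \<simeq> RDirProd_list Ds)"
proof -
  interpret uniserial_sequence R B A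
    by (intro uniserial_sequence.intro uniserial_sequence_axioms.intro
        sequence_endo.intro sequence_endo_axioms.intro) fact+
  obtain Ds where Ds: "1 \<le> length Ds" "length Ds \<le> card four_ideals" "\<forall>D\<in>set Ds. skew_field D"
      "set Ds \<subseteq> (Quot) E ` four_ideals" "E Quot jacobson_radical E \<simeq> RDirProd_list Ds"
    using four.quotient_by_jacobson_radical by (elim exE conjE)
  \<comment> \<open>Some of the four ideals may coincide, so the cardinality of
    \<open>four_ideals\<close> is bounded by the length of the list naming them.\<close>
  have "length Ds \<le> 4"
    using Ds(2) card_length[of "[I_ml R B A, I_el R B A, I_mu R B A, I_eu R B A]"] by simp
  show ?thesis
  proof (intro conjI ballI allI impI exI[of _ Ds])
    show "completely_prime_ideal P E" if "P \<in> four_ideals" for P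
      using that by (rule completely_prime_four_ideals)
    show "\<exists>P\<in>four_ideals. K \<subseteq> P" if "right_ideal K E \<and> K \<noteq> carrier E" for K
      using that by (elim conjE) (rule four.proper_right_ideal_subset_prime)
    show "\<exists>P\<in>four_ideals. K \<subseteq> P" if "left_ideal K E \<and> K \<noteq> carrier E" for K
      using that by (elim conjE) (rule four.proper_left_ideal_subset_prime)
    show "skew_field D" if "D \<in> set Ds" for D using Ds(3) that by (rule bspec)
    show "set Ds \<subseteq> {E Quot I_ml R B A, E Quot I_el R B A, E Quot I_mu R B A, E Quot I_eu R B A}"
      using Ds(4) by (simp only: image_insert image_empty)
  qed (fact Ds(1) \<open>length Ds \<le> 4\<close> Ds(5))+
qed

end
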